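(* Let $I\subseteq\mathbb{R}$ be a nonempty open interval, and let $\ell,H:I\to\mathbb{R}$ and $G_0:\ell(I)-\ell(I)\to\mathbb{R}$ be differentiable functions such that $\ell'$ does not vanish on $I$ and $H'$ is continuous. Then the triple $(G_0,\ell,H)$ satisfies $$G_0(\ell(x)-\ell(y))=H\Big(\frac{x+y}{2}\Big)-\frac{H(x)+H(y)}{2}\qquad\text{for all }x,y\in I$$ if and only if there exist real constants $A,B,C,D,E,\alpha,\beta$ with $CD\alpha\neq0$ such that one of the following possibilities holds (for all $x\in I$ and all $u\in\ell(I)-\ell(I)$): (i) $G_0(u)=0$, $\ell$ is arbitrary, $H(x)=Ax+B$; (ii) $G_0(u)=C(Du)^2$, $\ell(x)=\frac{1}{2D}x+E$, $H(x)=-Cx^2+Ax+B$; (iii) $G_0(u)=C(Du)^2$, $\ell(x)=\frac{1}{2D}e^{\alpha x}+E$, $H(x)=-\frac{C}{2}e^{2\alpha x}+Ax+B$; (iv) $G_0(u)=C\ln(\cosh(Du))$, $\ell(x)=\frac{1}{2D}\ln|\alpha x+\beta|+E$, $H(x)=C\ln|\alpha x+\beta|+Ax+B$; (v) $G_0(u)=C\ln(\cosh(Du))$, $\ell(x)=\frac{1}{2D}\ln|\tan(\alpha x+\beta)|+E$, $H(x)=C\ln|\sin(2\alpha x+2\beta)|+Ax+B$; (vi) $G_0(u)=C\ln(\cosh(Du))$, $\ell(x)=\frac{1}{2D}\ln|\tanh(\alpha x+\beta)|+E$, $H(x)=C\ln|\sinh(2\alpha x+2\beta)|+Ax+B$;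 (vii) $G_0(u)=C\ln(\cos(Du))$, $\ell(x)=\frac{1}{D}\arctan(\tanh(\alpha x+\beta))+E$, $H(x)=C\ln(\cosh(2\alpha x+2\beta))+Ax+B$. In addition, in cases (iv), (v) and (vi) one has, respectively, $0\notin\alpha I+\beta$; $\ \mathbb{Z}\cap\frac{2}{\pi}(\alpha I+\beta)=\emptyset$; and $0\notin\alpha I+\beta$.
   Context: $\ell(I)-\ell(I):=\{\ell(x)-\ell(y): x,y\in I\}$, and $\alpha I+\beta:=\{\alpha x+\beta: x\in I\}$. In case (i), "$\ell$ is arbitrary" means that no condition is imposed on $\ell$ beyond the standing hypotheses ($\ell$ differentiable with nowhere vanishing derivative). *)

theory Defs
  imports "HOL-Analysis.Analysis"
begin

definition diff_set :: "(real \<Rightarrow> real) \<Rightarrow> real set \<Rightarrow> real set" where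
  "diff_set l I = {l x - l y | x y. x \<in> I \<and> y \<in> I}"

definition affine_image :: "real \<Rightarrow> real \<Rightarrow> real set \<Rightarrow> real set" where
  "affine_image \<alpha> \<beta> I = (\<lambda>x. \<alpha> * x + \<beta>) ` I"

text \<open>
  The functions are total, but the predicates below constrain \<open>l\<close> and \<open>H\<close> only on \<open>I\<close> and \<open>G\<close>
  only on \<open>diff_set l I\<close>. None of them assumes that the arguments of the logarithms are nonzero.
\<close>

definition sol_trivial ::
  "real set \<Rightarrow> (real \<Rightarrow> real) \<Rightarrow> (real \<Rightarrow> real) \<Rightarrow> (real \<Rightarrow> real) \<Rightarrow> real \<Rightarrow> real \<Rightarrow> bool" where
  "sol_trivial I G l H A B \<longleftrightarrow>
     (\<forall>u \<in> diff_set l I. G u = 0) \<and>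
     (\<forall>x \<in> I. H x = A * x + B)"

definition sol_quadratic ::
  "real set \<Rightarrow> (real \<Rightarrow> real) \<Rightarrow> (real \<Rightarrow> real) \<Rightarrow> (real \<Rightarrow> real) \<Rightarrow>
   real \<Rightarrow> real \<Rightarrow> real \<Rightarrow> real \<Rightarrow> real \<Rightarrow> bool" where
  "sol_quadratic I G l H A B C D E \<longleftrightarrow>
     (\<forall>u \<in> diff_set l I. G u = C * (D * u)\<^sup>2) \<and>
     (\<forall>x \<in> I. l x = 1 / (2 * D) * x + E) \<and>
     (\<forall>x \<in> I. H x = - C * x\<^sup>2 + A * x + B)"

definition sol_exp ::
  "real set \<Rightarrow> (real \<Rightarrow> real) \<Rightarrow> (real \<Rightarrow> real) \<Rightarrow> (real \<Rightarrow> real) \<Rightarrow>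
   real \<Rightarrow> real \<Rightarrow> real \<Rightarrow> real \<Rightarrow> real \<Rightarrow> real \<Rightarrow> bool" where
  "sol_exp I G l H A B C D E \<alpha> \<longleftrightarrow>
     (\<forall>u \<in> diff_set l I. G u = C * (D * u)\<^sup>2) \<and>
     (\<forall>x \<in> I. l x = 1 / (2 * D) * exp (\<alpha> * x) + E) \<and>
     (\<forall>x \<in> I. H x = - (C / 2) * exp (2 * \<alpha> * x) + A * x + B)"

definition sol_ln ::
  "real set \<Rightarrow> (real \<Rightarrow> real) \<Rightarrow> (real \<Rightarrow> real) \<Rightarrow> (real \<Rightarrow> real) \<Rightarrow>
   real \<Rightarrow> real \<Rightarrow> real \<Rightarrow> real \<Rightarrow> real \<Rightarrow> real \<Rightarrow> real \<Rightarrow> bool" where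
  "sol_ln I G l H A B C D E \<alpha> \<beta> \<longleftrightarrow>
     (\<forall>u \<in> diff_set l I. G u = C * ln (cosh (D * u))) \<and>
     (\<forall>x \<in> I. l x = 1 / (2 * D) * ln \<bar>\<alpha> * x + \<beta>\<bar> + E) \<and>
     (\<forall>x \<in> I. H x = C * ln \<bar>\<alpha> * x + \<beta>\<bar> + A * x + B)"

definition sol_tan ::
  "real set \<Rightarrow> (real \<Rightarrow> real) \<Rightarrow> (real \<Rightarrow> real) \<Rightarrow> (real \<Rightarrow> real) \<Rightarrow>
   real \<Rightarrow> real \<Rightarrow> real \<Rightarrow> real \<Rightarrow> real \<Rightarrow> real \<Rightarrow> real \<Rightarrow> bool" where
  "sol_tan I G l H A B C D E \<alpha> \<beta> \<longleftrightarrow>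
     (\<forall>u \<in> diff_set l I. G u = C * ln (cosh (D * u))) \<and>
     (\<forall>x \<in> I. l x = 1 / (2 * D) * ln \<bar>tan (\<alpha> * x + \<beta>)\<bar> + E) \<and>
     (\<forall>x \<in> I. H x = C * ln \<bar>sin (2 * \<alpha> * x + 2 * \<beta>)\<bar> + A * x + B)"

definition sol_tanh ::
  "real set \<Rightarrow> (real \<Rightarrow> real) \<Rightarrow> (real \<Rightarrow> real) \<Rightarrow> (real \<Rightarrow> real) \<Rightarrow>
   real \<Rightarrow> real \<Rightarrow> real \<Rightarrow> real \<Rightarrow> real \<Rightarrow> real \<Rightarrow> real \<Rightarrow> bool" where
  "sol_tanh I G l H A B C D E \<alpha> \<beta> \<longleftrightarrow>
     (\<forall>u \<in> diff_set l I. G u = C * ln (cosh (D * u))) \<and>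
     (\<forall>x \<in> I. l x = 1 / (2 * D) * ln \<bar>tanh (\<alpha> * x + \<beta>)\<bar> + E) \<and>
     (\<forall>x \<in> I. H x = C * ln \<bar>sinh (2 * \<alpha> * x + 2 * \<beta>)\<bar> + A * x + B)"

definition sol_arctan ::
  "real set \<Rightarrow> (real \<Rightarrow> real) \<Rightarrow> (real \<Rightarrow> real) \<Rightarrow> (real \<Rightarrow> real) \<Rightarrow>
   real \<Rightarrow> real \<Rightarrow> real \<Rightarrow> real \<Rightarrow> real \<Rightarrow> real \<Rightarrow> real \<Rightarrow> bool" where
  "sol_arctan I G l H A B C D E \<alpha> \<beta> \<longleftrightarrow>
     (\<forall>u \<in> diff_set l I. G u = C * ln (cos (D * u))) \<and>
     (\<forall>x \<in> I. l x = 1 / D * arctan (tanh (\<alpha> * x + \<beta>)) + E) \<and>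
     (\<forall>x \<in> I. H x = C * ln (cosh (2 * \<alpha> * x + 2 * \<beta>)) + A * x + B)"

end

theory Submission
  imports Defs
begin

text \<open>
  Differentiating the equation in \<open>x\<close> and in \<open>y\<close> and eliminating the common value of \<open>G'\<close> gives,
  for \<open>w = 1 / l'\<close>, \<open>\<phi> = H'\<close> and \<open>m = (x + y) / 2\<close>,
  \<open>w x (\<phi> m - \<phi> x) = w y (\<phi> y - \<phi> m)\<close>
  (\<open>imp_weighted_midpoint\<close>). By Darboux's theorem \<open>l'\<close>, hence \<open>w\<close>, has constant sign, although it
  need not be continuous a priori. So \<open>\<phi> m\<close> is a proper weighted mean of \<open>\<phi> x\<close> and \<open>\<phi> y\<close>, and
  this forces \<open>\<phi>\<close> to be constant or injective (\<open>\<phi>_constant_or_inj\<close>). If \<open>\<phi>\<close> is constant,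
  then \<open>H\<close> is affine and \<open>G\<close> vanishes.

  If \<open>\<phi>\<close> is injective, solving for \<open>w x\<close> shows that \<open>w\<close> is continuous. Let \<open>W\<close> be an
  antiderivative of \<open>w\<close>. Integrating the equation over intervals symmetric about \<open>m\<close> gives
  \<open>\<phi> m (W x - W y) = P x - P y\<close> with \<open>P' = w \<phi>\<close>; therefore \<open>\<phi>\<close> is differentiable, then \<open>w\<close> is, and
  then \<open>\<phi>'\<close> is. Differentiating the integrated equation yields that \<open>\<phi>' w\<^sup>2\<close> is a nonzero
  constant \<open>k\<close> and that
  \<open>(W x - W y) (w' x + w' y) = (w x)\<^sup>2 - (w y)\<^sup>2\<close>
  (\<open>trapezoid_eq\<close>). Adding three of these identities shows that \<open>w'\<close> is an affine function of \<open>W\<close>,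
  so \<open>w'' = \<mu> w\<close> for a constant \<open>\<mu>\<close> (\<open>w_ode\<close>).

  The nowhere vanishing solutions \<open>w\<close> are nonzero constants, nonconstant affine functions,
  exponentials, and multiples of sines, hyperbolic sines and hyperbolic cosines
  (\<open>linear_ode2_cases\<close>); they correspond to the six nontrivial families. Each one gives \<open>l\<close> from
  \<open>l' = 1 / w\<close> and \<open>H\<close> from \<open>H'' = k / w\<^sup>2\<close> up to constants of integration, and then \<open>G\<close> is
  determined by the equation.

  Conversely, each family satisfies the equation by addition theorems, once it is known that the
  arguments of the logarithms do not vanish on the interval. At such a zero the logarithm would be
  unbounded nearby, which the continuity of \<open>l\<close> excludes
  (\<open>ln_abs_simple_zero_not_continuous\<close>).
\<close>

section \<open>Real functions on open intervals\<close>

text \<open>Darboux: a derivative that goes from positive to negative vanishes in between, even if it is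
  not continuous.\<close>

lemma derivative_sign_change_zero:
  fixes f f' :: "real \<Rightarrow> real"
  assumes "a < b" and der: "\<And>x. x \<in> {a..b} \<Longrightarrow> (f has_real_derivative f' x) (at x)"
    and "f' a > 0" "f' b < 0"
  shows "\<exists>x\<in>{a<..<b}. f' x = 0"
proof -
  have "continuous_on {a..b} f"
    using der by (meson DERIV_isCont continuous_at_imp_continuous_on)
  then obtain z where z: "z \<in> {a..b}" and max: "\<And>y. y \<in> {a..b} \<Longrightarrow> f y \<le> f z"
    using continuous_attains_sup[of "{a..b}" f] \<open>a < b\<close> by auto
  have "z \<noteq> a"
  proof
    assume "z = a"
    obtain d where d: "d > 0" "\<And>h. 0 < h \<Longrightarrow> h < d \<Longrightarrow> f a < f (a + h)"
      using DERIV_pos_inc_right[OF der[of a]] assms by auto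
    define h where "h = min (d / 2) (b - a)"
    have "0 < h" "h < d" "a + h \<in> {a..b}"
      using d(1) \<open>a < b\<close> by (auto simp: h_def min_def)
    then show False using d(2)[of h] max[of "a + h"] \<open>z = a\<close> by fastforce
  qed
  moreover have "z \<noteq> b"
  proof
    assume "z = b"
    obtain d where d: "d > 0" "\<And>h. 0 < h \<Longrightarrow> h < d \<Longrightarrow> f b < f (b - h)"
      using DERIV_neg_dec_left[OF der[of b]] assms by auto
    define h where "h = min (d / 2) (b - a)"
    have "0 < h" "h < d" "b - h \<in> {a..b}"
      using d(1) \<open>a < b\<close> by (auto simp: h_def min_def)
    then show False using d(2)[of h] max[of "b - h"] \<open>z = b\<close> by fastforce
  qed
  ultimately have z': "a < z" "z < b" using z by auto
  have "f' z = 0"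
  proof (rule DERIV_local_max[OF der[OF z]])
    show "0 < min (z - a) (b - z)" using z' by simp
    show "\<forall>y. \<bar>z - y\<bar> < min (z - a) (b - z) \<longrightarrow> f y \<le> f z"
      using max by (auto simp: abs_if split: if_splits)
  qed
  then show ?thesis using z' by auto
qed

lemma is_interval_Icc_subset:
  fixes I :: "real set"
  assumes "is_interval I" "a \<in> I" "b \<in> I"
  shows "{a..b} \<subseteq> I"
  using assms by (meson atLeastAtMost_iff is_interval_1 subsetI)

lemma is_interval_midpoint:
  fixes I :: "real set"
  assumes "is_interval I" "x \<in> I" "y \<in> I"
  shows "(x + y) / 2 \<in> I"
proof (cases "x \<le> y")
  case True
  then show ?thesis using is_interval_Icc_subset[OF assms] by force
next
  case False
  then show ?thesis using is_interval_Icc_subset[OF assms(1,3,2)] by force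
qed

lemma deriv_nonzero_same_sign:
  fixes f f' :: "real \<Rightarrow> real"
  assumes I: "is_interval I"
    and der: "\<And>x. x \<in> I \<Longrightarrow> (f has_real_derivative f' x) (at x)"
    and nz: "\<And>x. x \<in> I \<Longrightarrow> f' x \<noteq> 0"
    and xy: "x \<in> I" "y \<in> I"
  shows "f' x * f' y > 0"
proof -
  have no: "\<not> (g' a > 0 \<and> g' b < 0)"
    if "a < b" and ab: "a \<in> I" "b \<in> I"
      and g: "\<And>x. x \<in> I \<Longrightarrow> (g has_real_derivative g' x) (at x)"
      and gnz: "\<And>x. x \<in> I \<Longrightarrow> g' x \<noteq> 0"
    for a b and g g' :: "real \<Rightarrow> real"
    using derivative_sign_change_zero[OF \<open>a < b\<close>, of g g'] is_interval_Icc_subset[OF I ab] g gnz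
    by (meson greaterThanLessThan_subseteq_atLeastAtMost_iff order_refl subsetD)
  have sgn: "f' a * f' b > 0" if "a < b" "a \<in> I" "b \<in> I" for a b
  proof -
    have "\<not> (f' a > 0 \<and> f' b < 0)"
      using no[OF that, of f f'] der nz by blast
    moreover have "\<not> (- f' a > 0 \<and> - f' b < 0)"
      using no[OF that, of "\<lambda>x. - f x" "\<lambda>x. - f' x"] der nz
      by (metis DERIV_minus neg_equal_0_iff_equal)
    ultimately show ?thesis using nz[OF that(2)] nz[OF that(3)]
      by (auto simp: zero_less_mult_iff)
  qed
  consider "x < y" | "y < x" | "x = y" by linarith
  then show ?thesis
  proof cases
    case 3
    then show ?thesis using nz[OF xy(1)] by (metis not_real_square_gt_zero)
  qed (use sgn[of x y] sgn[of y x] xy in \<open>auto simp: mult.commute\<close>)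
qed

lemma continuous_nonzero_same_sign:
  fixes f :: "real \<Rightarrow> real"
  assumes I: "is_interval I" and f: "continuous_on I f"
    and nz: "\<And>x. x \<in> I \<Longrightarrow> f x \<noteq> 0" and xy: "x \<in> I" "y \<in> I"
  shows "f x * f y > 0"
proof -
  have "is_interval (f ` I)"
    using connected_continuous_image[OF f] I by (simp add: is_interval_connected_1)
  then have "f x \<le> 0 \<Longrightarrow> 0 \<le> f y \<Longrightarrow> 0 \<in> f ` I" "f y \<le> 0 \<Longrightarrow> 0 \<le> f x \<Longrightarrow> 0 \<in> f ` I"
    using xy unfolding is_interval_1 by blast+
  then show ?thesis using nz xy by (fastforce simp: zero_less_mult_iff)
qed

lemma DERIV_unique_on:
  fixes f g :: "real \<Rightarrow> real"
  assumes "(f has_real_derivative a) (at x)" "(g has_real_derivative b) (at x)"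
    and "open S" "x \<in> S" "\<And>t. t \<in> S \<Longrightarrow> f t = g t"
  shows "a = b"
  using has_field_derivative_transform_within_open[OF assms(1,3,4,5)] assms(2) DERIV_unique by blast

lemma same_deriv_eq_plus_const:
  fixes f g :: "real \<Rightarrow> real"
  assumes "is_interval I"
    and "\<And>x. x \<in> I \<Longrightarrow> (f has_real_derivative h x) (at x)"
    and "\<And>x. x \<in> I \<Longrightarrow> (g has_real_derivative h x) (at x)"
  obtains c where "\<And>x. x \<in> I \<Longrightarrow> f x = g x + c"
proof -
  have "((\<lambda>x. f x - g x) has_real_derivative 0) (at x within I)" if "x \<in> I" for x
    using DERIV_diff[OF assms(2,3)[OF that]] by (simp add: has_field_derivative_at_within)
  then obtain c where "\<And>x. x \<in> I \<Longrightarrow> f x - g x = c"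
    using has_field_derivative_zero_constant[of I "\<lambda>x. f x - g x"] assms(1)
    by (meson is_interval_convex)
  then show thesis using that[of c] by (simp add: algebra_simps)
qed

lemma open_interval_antiderivative:
  fixes f :: "real \<Rightarrow> real"
  assumes "open I" "is_interval I" and f: "continuous_on I f"
  obtains F where "\<And>x. x \<in> I \<Longrightarrow> (F has_real_derivative f x) (at x)"
proof (cases "I = {}")
  case False
  then obtain c where c: "c \<in> I" by blast
  have "((\<lambda>u. LBINT y=c..u. f y) has_real_derivative f x) (at x)" if x: "x \<in> I" for x
  proof -
    obtain d where d: "d > 0" "cball x d \<subseteq> I"
      using \<open>open I\<close> x open_contains_cball by blast
    define a b where "a = min c (x - d)" and "b = max c (x + d)"
    have "x - d \<in> I" "x + d \<in> I"
      using subsetD[OF d(2), of "x - d"] subsetD[OF d(2), of "x + d"] d(1)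
      by (simp_all add: dist_real_def)
    then have "a \<in> I" "b \<in> I" using c by (auto simp: a_def b_def min_def max_def)
    then have "continuous_on {a..b} f"
      by (intro continuous_on_subset[OF f] is_interval_Icc_subset[OF assms(2)])
    then have "((\<lambda>u. LBINT y=c..u. f y) has_vector_derivative f x) (at x within {a..b})"
      using d(1) by (intro interval_integral_FTC2) (auto simp: a_def b_def)
    moreover have "at x within {a..b} = at x"
      using d(1) by (intro at_within_Icc_at) (auto simp: a_def b_def)
    ultimately show ?thesis by (simp add: has_real_derivative_iff_has_vector_derivative)
  qed
  then show thesis by (rule that)
qed (use that in auto)

text \<open>The logarithm of a function with a simple zero is not continuous there. With the convention
  \<^term>\<open>ln (0::real) = 0\<close>, the value at the zero itself is finite, so continuity has to be
  refuted by points near the zero.\<close>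

lemma ln_abs_simple_zero_not_continuous:
  fixes f t :: "real \<Rightarrow> real"
  assumes I: "open I" "x\<^sub>0 \<in> I" and f: "continuous (at x\<^sub>0) f"
    and ft: "\<And>x. x \<in> I \<Longrightarrow> f x = ln \<bar>t x\<bar>"
    and t: "(t has_real_derivative d) (at x\<^sub>0)" "d \<noteq> 0" "t x\<^sub>0 = 0"
  shows False
proof -
  have nz: "eventually (\<lambda>x. t x \<noteq> 0) (at x\<^sub>0)"
  proof -
    have "((\<lambda>y. (t y - t x\<^sub>0) / (y - x\<^sub>0)) \<longlongrightarrow> d) (at x\<^sub>0)"
      using t(1) by (simp add: has_field_derivative_iff)
    then have "eventually (\<lambda>y. (t y - t x\<^sub>0) / (y - x\<^sub>0) \<noteq> 0) (at x\<^sub>0)"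
      using t(2) tendsto_imp_eventually_ne by blast
    then show ?thesis by eventually_elim (use t(3) in auto)
  qed
  have "eventually (\<lambda>x. x \<in> I) (at x\<^sub>0)" using I eventually_at_in_open' by blast
  with nz have "eventually (\<lambda>x. exp (f x) = \<bar>t x\<bar>) (at x\<^sub>0)"
    by eventually_elim (simp add: ft)
  moreover have "((\<lambda>x. exp (f x)) \<longlongrightarrow> exp (f x\<^sub>0)) (at x\<^sub>0)"
    using f by (intro tendsto_intros) (simp add: continuous_at)
  ultimately have "((\<lambda>x. \<bar>t x\<bar>) \<longlongrightarrow> exp (f x\<^sub>0)) (at x\<^sub>0)"
    by (rule Lim_transform_eventually[rotated])
  moreover have "((\<lambda>x. \<bar>t x\<bar>) \<longlongrightarrow> 0) (at x\<^sub>0)"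
    using DERIV_isCont[OF t(1)] t(3) by (auto simp: continuous_at intro: tendsto_rabs_zero)
  ultimately show False using tendsto_unique[of "at x\<^sub>0"] by force
qed

section \<open>The weighted midpoint equation\<close>

text \<open>The equation says that \<open>\<phi> ((x + y) / 2)\<close> is the mean of \<open>\<phi> x\<close> and \<open>\<phi> y\<close> with weights
  \<open>w x\<close> and \<open>w y\<close>; it is written without division. The function \<open>w\<close> may have either
  constant sign, and nothing is assumed about its regularity. For the original equation \<open>w\<close> is
  \<open>1 / l'\<close> and \<open>\<phi>\<close> is \<open>H'\<close>.\<close>

locale weighted_midpoint =
  fixes I :: "real set" and w \<phi> :: "real \<Rightarrow> real"
  assumes open_I: "open I" and interval_I: "is_interval I"
    and cont_\<phi>: "continuous_on I \<phi>"
    and w_same_sign: "\<And>x y. x \<in> I \<Longrightarrow> y \<in> I \<Longrightarrow> w x * w y > 0"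
    and midpoint_eq: "\<And>x y. x \<in> I \<Longrightarrow> y \<in> I \<Longrightarrow>
      w x * (\<phi> ((x + y) / 2) - \<phi> x) = w y * (\<phi> y - \<phi> ((x + y) / 2))"
begin

lemma w_nonzero: "x \<in> I \<Longrightarrow> w x \<noteq> 0"
  using w_same_sign[of x x] by auto

lemma midpoint_in: "x \<in> I \<Longrightarrow> y \<in> I \<Longrightarrow> (x + y) / 2 \<in> I"
  using interval_I by (rule is_interval_midpoint)

lemma \<phi>_midpoint_eq_end:
  assumes "x \<in> I" "y \<in> I" "\<phi> ((x + y) / 2) = \<phi> x"
  shows "\<phi> y = \<phi> x"
  using midpoint_eq[OF assms(1,2)] assms(3) w_nonzero[OF assms(2)] by simp

lemma \<phi>_midpoint_between:
  assumes xy: "x \<in> I" "y \<in> I" and "\<phi> x \<le> M" "\<phi> y \<le> M" and M: "\<phi> ((x + y) / 2) = M"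
  shows "\<phi> x = M \<and> \<phi> y = M"
proof -
  have eq: "w x * (M - \<phi> x) = w y * (\<phi> y - M)" using midpoint_eq[OF xy] M by simp
  have "(w x * w y) * (M - \<phi> x) = (w y)\<^sup>2 * (\<phi> y - M)"
    using arg_cong[OF eq, of "\<lambda>t. w y * t"] by (simp add: algebra_simps power2_eq_square)
  moreover have "(w x * w y) * (M - \<phi> x) \<ge> 0" "(w y)\<^sup>2 * (\<phi> y - M) \<le> 0"
    using w_same_sign[OF xy] assms by (simp_all add: mult_nonneg_nonpos)
  ultimately have "(w x * w y) * (M - \<phi> x) = 0" "(w y)\<^sup>2 * (\<phi> y - M) = 0" by linarith+
  then show ?thesis using w_nonzero xy by simp
qed

lemma \<phi>_le_ends:
  assumes xy: "x \<in> I" "y \<in> I" and eq: "\<phi> x = \<phi> y" and t: "t \<in> {x..y}"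
  shows "\<phi> t \<le> \<phi> x"
proof (rule ccontr)
  assume gt: "\<not> \<phi> t \<le> \<phi> x"
  have sub: "{x..y} \<subseteq> I" using is_interval_Icc_subset[OF interval_I xy] .
  then have "continuous_on {x..y} \<phi>" using cont_\<phi> continuous_on_subset by blast
  then obtain z where z: "z \<in> {x..y}" and max: "\<And>u. u \<in> {x..y} \<Longrightarrow> \<phi> u \<le> \<phi> z"
    using continuous_attains_sup[of "{x..y}" \<phi>] t by force
  have "\<phi> z > \<phi> x" using max[OF t] gt by simp
  then have strict: "x < z" "z < y" using z eq by (auto simp: less_le)
  \<comment> \<open>Reflecting the nearer end point in the maximum point keeps both points in the interval.\<close>
  define h where "h = min (z - x) (y - z)"
  have h: "z - h \<in> {x..y}" "z + h \<in> {x..y}" "z - h = x \<or> z + h = y"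
    using strict by (auto simp: h_def min_def)
  have "\<phi> (z - h) = \<phi> z \<and> \<phi> (z + h) = \<phi> z"
    using h sub max by (intro \<phi>_midpoint_between) auto
  then show False using h(3) eq \<open>\<phi> z > \<phi> x\<close> by auto
qed

lemma weighted_midpoint_uminus: "weighted_midpoint I w (\<lambda>x. - \<phi> x)"
proof
  fix x y assume "x \<in> I" "y \<in> I"
  then show "w x * (- \<phi> ((x + y) / 2) - - \<phi> x) = w y * (- \<phi> y - - \<phi> ((x + y) / 2))"
    using midpoint_eq[of x y] by (simp add: algebra_simps)
qed (use open_I interval_I cont_\<phi> w_same_sign in \<open>auto intro: continuous_intros\<close>)

text \<open>If \<^term>\<open>\<phi>\<close> repeats a value, then it is constant between the two points, and the halving
  maps \<open>t \<mapsto> (p + t) / 2\<close> carry every other point into a neighbourhood of \<open>p\<close> on which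
  \<^term>\<open>\<phi>\<close> is constant.\<close>

lemma \<phi>_constant_or_inj:
  "(\<exists>c. \<forall>x\<in>I. \<phi> x = c) \<or> inj_on \<phi> I"
proof (rule disjCI)
  assume "\<not> inj_on \<phi> I"
  then obtain x y where xy: "x \<in> I" "y \<in> I" "x < y" "\<phi> x = \<phi> y"
    unfolding inj_on_def by (metis (lifting) linorder_neqE_linordered_idom)
  have const: "\<phi> t = \<phi> x" if "t \<in> {x..y}" for t
    using \<phi>_le_ends[OF xy(1,2,4) that]
      weighted_midpoint.\<phi>_le_ends[OF weighted_midpoint_uminus xy(1,2) _ that] xy(4) by simp
  define p where "p = (x + y) / 2"
  have p: "p \<in> I" "x < p" "p < y" using midpoint_in[OF xy(1,2)] xy(3) by (auto simp: p_def)
  have halving: "t \<in> I \<Longrightarrow> \<phi> (p + (t - p) / 2 ^ n) = \<phi> p \<Longrightarrow> \<phi> t = \<phi> p" for n t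
  proof (induction n arbitrary: t)
    case (Suc n)
    have m: "(p + t) / 2 \<in> I" using midpoint_in[OF p(1) Suc.prems(1)] .
    have "(p + t) / 2 - p = (t - p) / 2" by (simp add: field_simps)
    then have "p + ((p + t) / 2 - p) / 2 ^ n = p + (t - p) / 2 ^ Suc n" by simp
    then have "\<phi> ((p + t) / 2) = \<phi> p" using Suc.IH[OF m] Suc.prems(2) by metis
    then show ?case using \<phi>_midpoint_eq_end[OF p(1) Suc.prems(1)] by simp
  qed simp
  have "\<phi> t = \<phi> p" if t: "t \<in> I" for t
  proof -
    have "(\<lambda>n. p + (t - p) / 2 ^ n) \<longlonglongrightarrow> p + 0"
      by (intro tendsto_add tendsto_const LIMSEQ_divide_realpow_zero) simp
    then have "eventually (\<lambda>n. p + (t - p) / 2 ^ n \<in> {x<..<y}) sequentially"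
      using p by (intro topological_tendstoD) auto
    then obtain n where "p + (t - p) / 2 ^ n \<in> {x<..<y}"
      using eventually_happens trivial_limit_sequentially by blast
    then have "\<phi> (p + (t - p) / 2 ^ n) = \<phi> p"
      using const[of "p + (t - p) / 2 ^ n"] const[of p] p by simp
    then show ?thesis using halving t by blast
  qed
  then show "\<exists>c. \<forall>x\<in>I. \<phi> x = c" by blast
qed

end

text \<open>In the remaining case \<open>\<phi>\<close> takes no value twice, so the equation can be solved for \<open>w x\<close>.
  This lets regularity pass back and forth between \<open>w\<close> and \<open>\<phi>\<close>.\<close>

locale injective_weighted_midpoint = weighted_midpoint +
  assumes inj_\<phi>: "inj_on \<phi> I"
begin

lemma \<phi>_eq_iff: "x \<in> I \<Longrightarrow> y \<in> I \<Longrightarrow> \<phi> x = \<phi> y \<longleftrightarrow> x = y"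
  using inj_\<phi> by (auto simp: inj_on_def)

lemma neighbourhood_in:
  assumes "m \<in> I"
  obtains h where "h > 0" "\<And>t. \<bar>t - m\<bar> \<le> h \<Longrightarrow> t \<in> I"
proof -
  obtain d where "d > 0" "cball m d \<subseteq> I"
    using open_I assms open_contains_cball by blast
  then show thesis
    by (intro that[of d]) (auto simp: dist_real_def abs_minus_commute dest: subsetD)
qed

lemma other_point:
  assumes "x \<in> I" obtains y where "y \<in> I" "y \<noteq> x"
proof -
  obtain h where "h > 0" "\<And>t. \<bar>t - x\<bar> \<le> h \<Longrightarrow> t \<in> I"
    using neighbourhood_in[OF assms] by metis
  then have "x + h \<in> I" "x + h \<noteq> x" by auto
  then show thesis by (rule that)
qed

lemma w_eq_quotient:
  assumes "x \<in> I" "y \<in> I" "x \<noteq> y"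
  shows "w x = w y * (\<phi> y - \<phi> ((x + y) / 2)) / (\<phi> ((x + y) / 2) - \<phi> x)"
proof -
  have "\<phi> ((x + y) / 2) \<noteq> \<phi> x"
    using assms midpoint_in[OF assms(1,2)] \<phi>_eq_iff[of "(x + y) / 2" x] by auto
  then show ?thesis using midpoint_eq[OF assms(1,2)] by (simp add: field_simps)
qed

lemma \<phi>_isCont: "x \<in> I \<Longrightarrow> isCont \<phi> x"
  using cont_\<phi> open_I continuous_on_eq_continuous_at by blast

lemma cont_w: "continuous_on I w"
proof (rule continuous_at_imp_continuous_on, rule ballI)
  fix x assume x: "x \<in> I"
  then obtain y where y: "y \<in> I" "y \<noteq> x" by (rule other_point)
  have m: "(x + y) / 2 \<in> I" using midpoint_in x y by blast
  have ne: "\<phi> ((x + y) / 2) - \<phi> x \<noteq> 0" using \<phi>_eq_iff[OF m x] y by auto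
  have cm: "isCont (\<lambda>t. \<phi> ((t + y) / 2)) x"
    using isCont_o2[where f = "\<lambda>t. (t + y) / 2" and a = x and g = \<phi>] \<phi>_isCont[OF m]
    by (simp add: continuous_intros)
  have "isCont (\<lambda>t. w y * (\<phi> y - \<phi> ((t + y) / 2)) / (\<phi> ((t + y) / 2) - \<phi> t)) x"
    using ne by (intro continuous_intros cm \<phi>_isCont[OF x]) auto
  moreover have "eventually (\<lambda>t. t \<in> I - {y}) (nhds x)"
    using x y open_I by (intro eventually_nhds_in_open) (auto intro: open_Diff)
  then have "eventually (\<lambda>t. w y * (\<phi> y - \<phi> ((t + y) / 2)) / (\<phi> ((t + y) / 2) - \<phi> t) = w t)
      (nhds x)"
    by eventually_elim (use w_eq_quotient y in auto)
  ultimately show "isCont w x" using isCont_cong by fast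
qed

text \<open>An antiderivative of \<^term>\<open>w\<close> on \<^term>\<open>I\<close>, with an arbitrary constant of integration and
  arbitrary values outside \<^term>\<open>I\<close>. Only differences \<^term>\<open>W x - W y\<close> with both points in
  \<^term>\<open>I\<close> matter.\<close>

definition W :: "real \<Rightarrow> real" where
  "W = (SOME F. \<forall>x\<in>I. (F has_real_derivative w x) (at x))"

lemma W_deriv: "x \<in> I \<Longrightarrow> (W has_real_derivative w x) (at x)"
proof -
  obtain F where "\<And>x. x \<in> I \<Longrightarrow> (F has_real_derivative w x) (at x)"
    using open_interval_antiderivative[OF open_I interval_I cont_w] by blast
  then have "\<forall>x\<in>I. (W has_real_derivative w x) (at x)"
    unfolding W_def by (intro someI_ex[of "\<lambda>F. \<forall>x\<in>I. (F has_real_derivative w x) (at x)"]) blast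
  then show "x \<in> I \<Longrightarrow> (W has_real_derivative w x) (at x)" by blast
qed

lemmas W_deriv_chain [derivative_intros] = DERIV_chain2[OF W_deriv]

lemma W_eq_iff:
  assumes "x \<in> I" "y \<in> I" shows "W x = W y \<longleftrightarrow> x = y"
proof -
  have "W a \<noteq> W b" if ab: "a < b" "a \<in> I" "b \<in> I" for a b
  proof -
    have sub: "{a..b} \<subseteq> I" using is_interval_Icc_subset[OF interval_I ab(2,3)] .
    then obtain z where "a < z" "z < b" "W b - W a = (b - a) * w z"
      using MVT2[OF ab(1), of W w] W_deriv by (meson atLeastAtMost_iff subsetD)
    then show ?thesis using w_nonzero[of z] subsetD[OF sub, of z] ab(1) by auto
  qed
  then show ?thesis using assms by (metis linorder_neqE_linordered_idom)
qed

lemma symmetric_interval: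
  shows "open {s. m + s \<in> I \<and> m - s \<in> I}" "is_interval {s. m + s \<in> I \<and> m - s \<in> I}"
proof -
  have "{s. m + s \<in> I \<and> m - s \<in> I} = (\<lambda>s. m + s) -` I \<inter> (\<lambda>s. m - s) -` I" by auto
  then show "open {s. m + s \<in> I \<and> m - s \<in> I}"
    using open_I by (auto intro!: open_Int open_vimage continuous_intros)
  show "is_interval {s. m + s \<in> I \<and> m - s \<in> I}"
    unfolding is_interval_1
  proof (intro ballI allI impI)
    fix a b x assume ab: "a \<in> {s. m + s \<in> I \<and> m - s \<in> I}" "b \<in> {s. m + s \<in> I \<and> m - s \<in> I}"
      and x: "a \<le> x \<and> x \<le> b"
    have "m + x \<in> {m + a..m + b}" "m - x \<in> {m - b..m - a}" using x by auto
    moreover have "{m + a..m + b} \<subseteq> I" "{m - b..m - a} \<subseteq> I"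
      using ab by (simp_all add: is_interval_Icc_subset[OF interval_I])
    ultimately show "x \<in> {s. m + s \<in> I \<and> m - s \<in> I}" by blast
  qed
qed

text \<open>The equation integrated over intervals symmetric about the midpoint.\<close>

lemma integrated_eq:
  obtains P where "\<And>x. x \<in> I \<Longrightarrow> (P has_real_derivative w x * \<phi> x) (at x)"
    and "\<And>x y. x \<in> I \<Longrightarrow> y \<in> I \<Longrightarrow> \<phi> ((x + y) / 2) * (W x - W y) = P x - P y"
proof -
  obtain P where P: "\<And>x. x \<in> I \<Longrightarrow> (P has_real_derivative w x * \<phi> x) (at x)"
    using open_interval_antiderivative[OF open_I interval_I, of "\<lambda>x. w x * \<phi> x"] cont_w cont_\<phi>
    by (auto intro: continuous_intros)
  note P' [derivative_intros] = DERIV_chain2[OF P]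
  have "\<phi> ((x + y) / 2) * (W x - W y) = P x - P y" if xy: "x \<in> I" "y \<in> I" for x y
  proof -
    define m where "m = (x + y) / 2"
    define J where "J = {s. m + s \<in> I \<and> m - s \<in> I}"
    have J: "is_interval J" unfolding J_def by (rule symmetric_interval)
    have 1: "((\<lambda>s. \<phi> m * (W (m + s) - W (m - s))) has_real_derivative
        \<phi> m * (w (m + s) + w (m - s))) (at s)" if "s \<in> J" for s
      using that unfolding J_def by (auto intro!: derivative_eq_intros)
    have 2: "((\<lambda>s. P (m + s) - P (m - s)) has_real_derivative
        \<phi> m * (w (m + s) + w (m - s))) (at s)" if "s \<in> J" for s
    proof -
      have s: "m + s \<in> I" "m - s \<in> I" using that by (auto simp: J_def)
      have "\<phi> m * (w (m + s) + w (m - s)) = w (m + s) * \<phi> (m + s) + w (m - s) * \<phi> (m - s)"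
        using midpoint_eq[OF s] by (simp add: algebra_simps)
      then show ?thesis using s by (auto intro!: derivative_eq_intros)
    qed
    obtain c where c: "\<And>s. s \<in> J \<Longrightarrow> \<phi> m * (W (m + s) - W (m - s)) = P (m + s) - P (m - s) + c"
      using same_deriv_eq_plus_const[OF J 1 2] by blast
    have "0 \<in> J" "(x - y) / 2 \<in> J"
      using xy midpoint_in[OF xy] by (simp_all add: J_def m_def field_simps)
    moreover have "m + (x - y) / 2 = x" "m - (x - y) / 2 = y" by (simp_all add: m_def field_simps)
    ultimately have "\<phi> m * (W x - W y) = P x - P y"
      using c[of 0] c[of "(x - y) / 2"] by simp
    then show ?thesis by (simp add: m_def)
  qed
  with P show thesis by (rule that)
qed

text \<open>The integrated equation exhibits \<^term>\<open>\<phi>\<close> near a point as a quotient of two differentiable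
  functions.\<close>

lemma \<phi>_deriv:
  assumes m: "m \<in> I" shows "(\<phi> has_real_derivative deriv \<phi> m) (at m)"
proof -
  obtain P where P: "\<And>x. x \<in> I \<Longrightarrow> (P has_real_derivative w x * \<phi> x) (at x)"
    and eq: "\<And>x y. x \<in> I \<Longrightarrow> y \<in> I \<Longrightarrow> \<phi> ((x + y) / 2) * (W x - W y) = P x - P y"
    by (rule integrated_eq) blast
  note P' [derivative_intros] = DERIV_chain2[OF P]
  obtain h where h: "h > 0" "\<And>t. \<bar>t - m\<bar> \<le> h \<Longrightarrow> t \<in> I" using neighbourhood_in[OF m] by blast
  define r where "r = h / 2"
  have r: "r > 0" using h by (simp add: r_def)
  have in_I: "t + r \<in> I" "t - r \<in> I" if "\<bar>t - m\<bar> < r" for t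
    using that by (auto intro!: h(2) simp: r_def abs_if field_simps split: if_splits)
  have W_ne: "W (m + r) - W (m - r) \<noteq> 0" using W_eq_iff[of "m + r" "m - r"] in_I[of m] r by simp
  have "(\<lambda>t. (P (t + r) - P (t - r)) / (W (t + r) - W (t - r))) field_differentiable at m"
    unfolding field_differentiable_def using in_I[of m] r W_ne
    by (intro exI) (auto intro!: derivative_eq_intros)
  moreover have "(P (t + r) - P (t - r)) / (W (t + r) - W (t - r)) = \<phi> t" if "\<bar>t - m\<bar> < r" for t
    using eq[OF in_I[OF that]] W_eq_iff[OF in_I[OF that]] r by (simp add: field_simps)
  ultimately have "\<phi> field_differentiable at m"
    using r by (elim field_differentiable_transform_within[rotated 3]) (auto simp: dist_real_def)
  then show ?thesis by (rule field_differentiable_derivI)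
qed

lemmas \<phi>_deriv_chain [derivative_intros] = DERIV_chain2[OF \<phi>_deriv]

lemma w_deriv:
  assumes x: "x \<in> I" shows "(w has_real_derivative deriv w x) (at x)"
proof -
  obtain y where y: "y \<in> I" "y \<noteq> x" using other_point[OF x] .
  have m: "(x + y) / 2 \<in> I" using midpoint_in[OF x y(1)] .
  have ne: "\<phi> ((x + y) / 2) - \<phi> x \<noteq> 0" using \<phi>_eq_iff[OF m x] y by auto
  have "(\<lambda>t. w y * (\<phi> y - \<phi> ((t + y) / 2)) / (\<phi> ((t + y) / 2) - \<phi> t)) field_differentiable at x"
    unfolding field_differentiable_def using m x ne
    by (intro exI) (auto intro!: derivative_eq_intros)
  then obtain D where D: "((\<lambda>t. w y * (\<phi> y - \<phi> ((t + y) / 2)) / (\<phi> ((t + y) / 2) - \<phi> t))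
      has_real_derivative D) (at x)" unfolding field_differentiable_def ..
  have "(w has_real_derivative D) (at x)"
  proof (rule has_field_derivative_transform_within_open[OF D])
    show "open (I - {y})" "x \<in> I - {y}" using open_I x y by (auto intro: open_Diff)
    show "w y * (\<phi> y - \<phi> ((t + y) / 2)) / (\<phi> ((t + y) / 2) - \<phi> t) = w t" if "t \<in> I - {y}" for t
      using w_eq_quotient[of t y] that y(1) by simp
  qed
  then show ?thesis by (metis DERIV_imp_deriv)
qed

lemmas w_deriv_chain [derivative_intros] = DERIV_chain2[OF w_deriv]

text \<open>The derivative of the integrated equation with respect to \<open>x\<close>.\<close>

lemma first_derivative_eq:
  assumes x: "x \<in> I" and y: "y \<in> I"
  shows "deriv \<phi> ((x + y) / 2) / 2 * (W x - W y) = w x * (\<phi> x - \<phi> ((x + y) / 2))"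
proof -
  obtain P where P: "\<And>x. x \<in> I \<Longrightarrow> (P has_real_derivative w x * \<phi> x) (at x)"
    and eq: "\<And>x y. x \<in> I \<Longrightarrow> y \<in> I \<Longrightarrow> \<phi> ((x + y) / 2) * (W x - W y) = P x - P y"
    by (rule integrated_eq) blast
  have 1: "((\<lambda>s. \<phi> ((s + y) / 2) * (W s - W y)) has_real_derivative
      deriv \<phi> ((x + y) / 2) / 2 * (W x - W y) + \<phi> ((x + y) / 2) * w x) (at x)"
    using midpoint_in[OF x y] x by (auto intro!: derivative_eq_intros)
  have 2: "((\<lambda>s. P s - P y) has_real_derivative w x * \<phi> x) (at x)"
    using P[OF x] by (auto intro!: derivative_eq_intros)
  have "deriv \<phi> ((x + y) / 2) / 2 * (W x - W y) + \<phi> ((x + y) / 2) * w x = w x * \<phi> x"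
    by (rule DERIV_unique_on[OF 1 2 open_I x eq[OF _ y]])
  then show ?thesis by (simp add: algebra_simps)
qed

text \<open>With \<open>x\<close> fixed and \<open>y = 2 t - x\<close>, so that the midpoint is \<open>t\<close>, the equation
  \<open>first_derivative_eq\<close> expresses \<open>\<phi>' t\<close> by differentiable functions of \<open>t\<close>.\<close>

lemma deriv_\<phi>_deriv:
  assumes m: "m \<in> I" shows "(deriv \<phi> has_real_derivative deriv (deriv \<phi>) m) (at m)"
proof -
  obtain h where h: "h > 0" "\<And>t. \<bar>t - m\<bar> \<le> h \<Longrightarrow> t \<in> I" using neighbourhood_in[OF m] by blast
  define x where "x = m + h / 2"
  have x: "x \<in> I" using h by (auto intro!: h(2) simp: x_def)
  have in_I: "2 * t - x \<in> I" "t \<in> I" "x \<noteq> 2 * t - x" if "\<bar>t - m\<bar> < h / 4" for t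
    using that h(1) by (auto intro!: h(2) simp: x_def abs_if field_simps split: if_splits)
  have W_ne: "W x - W (2 * m - x) \<noteq> 0" using W_eq_iff[OF x in_I(1)[of m]] in_I(3)[of m] h(1) by simp
  have "(\<lambda>t. 2 * w x * (\<phi> x - \<phi> t) / (W x - W (2 * t - x))) field_differentiable at m"
    unfolding field_differentiable_def using in_I[of m] h(1) m W_ne
    by (intro exI) (auto intro!: derivative_eq_intros)
  moreover have "2 * w x * (\<phi> x - \<phi> t) / (W x - W (2 * t - x)) = deriv \<phi> t"
    if t: "\<bar>t - m\<bar> < h / 4" for t
    using first_derivative_eq[OF x in_I(1)[OF t]] W_eq_iff[OF x in_I(1)[OF t]] in_I(3)[OF t]
    by (simp add: field_simps)
  ultimately have "deriv \<phi> field_differentiable at m"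
    using h(1) by (elim field_differentiable_transform_within[rotated 3, where d = "h / 4"])
      (auto simp: dist_real_def)
  then show ?thesis by (rule field_differentiable_derivI)
qed

lemmas deriv_\<phi>_deriv_chain [derivative_intros] = DERIV_chain2[OF deriv_\<phi>_deriv]

text \<open>The derivative of \<open>first_derivative_eq\<close> with respect to \<open>y\<close>.\<close>

lemma second_derivative_eq:
  assumes x: "x \<in> I" and y: "y \<in> I"
  shows "deriv (deriv \<phi>) ((x + y) / 2) / 2 * (W x - W y) = deriv \<phi> ((x + y) / 2) * (w y - w x)"
proof -
  have 1: "((\<lambda>s. deriv \<phi> ((x + s) / 2) / 2 * (W x - W s)) has_real_derivative
      deriv (deriv \<phi>) ((x + y) / 2) / 4 * (W x - W y) - deriv \<phi> ((x + y) / 2) / 2 * w y) (at y)"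
    using midpoint_in[OF x y] y by (auto intro!: derivative_eq_intros)
  have 2: "((\<lambda>s. w x * (\<phi> x - \<phi> ((x + s) / 2))) has_real_derivative
      - (w x * (deriv \<phi> ((x + y) / 2) / 2))) (at y)"
    using midpoint_in[OF x y] by (auto intro!: derivative_eq_intros)
  have "deriv (deriv \<phi>) ((x + y) / 2) / 4 * (W x - W y) - deriv \<phi> ((x + y) / 2) / 2 * w y
      = - (w x * (deriv \<phi> ((x + y) / 2) / 2))"
    by (rule DERIV_unique_on[OF 1 2 open_I y first_derivative_eq[OF x]])
  then show ?thesis by (simp add: field_simps)
qed

text \<open>The equation \<open>second_derivative_eq\<close> at \<open>m + s\<close> and \<open>m - s\<close>, to first order in \<open>s\<close>.\<close>

lemma \<phi>_ode:
  assumes m: "m \<in> I" shows "deriv (deriv \<phi>) m * w m = - 2 * deriv \<phi> m * deriv w m"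
proof -
  let ?J = "{s. m + s \<in> I \<and> m - s \<in> I}"
  have 1: "((\<lambda>s. deriv (deriv \<phi>) m / 2 * (W (m + s) - W (m - s))) has_real_derivative
      deriv (deriv \<phi>) m * w m) (at 0)"
    using m by (auto intro!: derivative_eq_intros)
  have 2: "((\<lambda>s. deriv \<phi> m * (w (m - s) - w (m + s))) has_real_derivative
      - 2 * deriv \<phi> m * deriv w m) (at 0)"
    using m by (auto intro!: derivative_eq_intros)
  have "deriv (deriv \<phi>) m / 2 * (W (m + s) - W (m - s)) = deriv \<phi> m * (w (m - s) - w (m + s))"
    if "s \<in> ?J" for s
    using second_derivative_eq[of "m + s" "m - s"] that by simp
  then show ?thesis
    using m by (intro DERIV_unique_on[OF 1 2 symmetric_interval(1)[of m]]) auto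
qed

lemma deriv_\<phi>_times_w_squared:
  obtains k where "k \<noteq> 0" "\<And>x. x \<in> I \<Longrightarrow> deriv \<phi> x * (w x)\<^sup>2 = k"
proof (cases "I = {}")
  case True
  then show thesis using that[of 1] by simp
next
  case False
  have 1: "((\<lambda>x. deriv \<phi> x * (w x)\<^sup>2) has_real_derivative 0) (at x)" if x: "x \<in> I" for x
  proof -
    have "deriv (deriv \<phi>) x * (w x)\<^sup>2 + deriv \<phi> x * (2 * w x * deriv w x)
        = w x * (deriv (deriv \<phi>) x * w x + 2 * deriv \<phi> x * deriv w x)"
      by (simp add: algebra_simps power2_eq_square)
    also have "\<dots> = 0" using \<phi>_ode[OF x] by simp
    finally show ?thesis
      using x by (auto intro!: derivative_eq_intros simp: algebra_simps)
  qed
  have 2: "((\<lambda>x. 0) has_real_derivative 0) (at x)" for x :: real by simp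
  obtain k where k: "\<And>x. x \<in> I \<Longrightarrow> deriv \<phi> x * (w x)\<^sup>2 = 0 + k"
    using same_deriv_eq_plus_const[OF interval_I 1 2] by blast
  have "k \<noteq> 0"
  proof
    assume "k = 0"
    then have "deriv \<phi> x = 0" if "x \<in> I" for x using k[OF that] w_nonzero[OF that] by simp
    then have 3: "(\<phi> has_real_derivative 0) (at x)" if "x \<in> I" for x
      using \<phi>_deriv[OF that] that by simp
    obtain c where c: "\<And>x. x \<in> I \<Longrightarrow> \<phi> x = 0 + c"
      using same_deriv_eq_plus_const[OF interval_I 3 2] by blast
    obtain x where "x \<in> I" using False by blast
    moreover then obtain y where "y \<in> I" "y \<noteq> x" by (rule other_point)
    ultimately show False using c \<phi>_eq_iff[of x y] by auto
  qed
  then show thesis using that[of k] k by simp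
qed

lemma deriv_\<phi>_nonzero: "x \<in> I \<Longrightarrow> deriv \<phi> x \<noteq> 0"
  using deriv_\<phi>_times_w_squared by (metis mult_zero_left)

lemma deriv_w_midpoint:
  assumes x: "x \<in> I" and y: "y \<in> I"
  shows "deriv w ((x + y) / 2) * (W x - W y) = w ((x + y) / 2) * (w x - w y)"
proof -
  let ?m = "(x + y) / 2"
  have m: "?m \<in> I" using midpoint_in[OF x y] .
  have "deriv \<phi> ?m * (deriv w ?m * (W x - W y))
      = - (deriv (deriv \<phi>) ?m * w ?m) / 2 * (W x - W y)"
    using \<phi>_ode[OF m] by simp
  also have "\<dots> = - w ?m * (deriv (deriv \<phi>) ?m / 2 * (W x - W y))" by simp
  also have "\<dots> = deriv \<phi> ?m * (w ?m * (w x - w y))"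
    unfolding second_derivative_eq[OF x y] by (simp add: algebra_simps)
  finally show ?thesis using deriv_\<phi>_nonzero[OF m] by simp
qed

text \<open>The derivative of the preceding equation with respect to half the distance of the two points,
  the midpoint being fixed.\<close>

lemma deriv_w_midpoint_sum:
  assumes x: "x \<in> I" and y: "y \<in> I"
  shows "deriv w ((x + y) / 2) * (w x + w y) = w ((x + y) / 2) * (deriv w x + deriv w y)"
proof -
  define m where "m = (x + y) / 2"
  define r where "r = (x - y) / 2"
  have xy: "m + r = x" "m - r = y" by (simp_all add: m_def r_def field_simps)
  have m: "m \<in> I" using midpoint_in[OF x y] by (simp add: m_def)
  have 1: "((\<lambda>s. deriv w m * (W (m + s) - W (m - s))) has_real_derivative
      deriv w m * (w x + w y)) (at r)"
    using x y by (auto intro!: derivative_eq_intros simp: xy)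
  have 2: "((\<lambda>s. w m * (w (m + s) - w (m - s))) has_real_derivative
      w m * (deriv w x + deriv w y)) (at r)"
    using x y by (auto intro!: derivative_eq_intros simp: xy)
  have "deriv w m * (W (m + s) - W (m - s)) = w m * (w (m + s) - w (m - s))"
    if "s \<in> {s. m + s \<in> I \<and> m - s \<in> I}" for s
    using deriv_w_midpoint[of "m + s" "m - s"] that by simp
  then have "deriv w m * (w x + w y) = w m * (deriv w x + deriv w y)"
    using x y by (intro DERIV_unique_on[OF 1 2 symmetric_interval(1)[of m]]) (auto simp: xy)
  then show ?thesis by (simp add: m_def)
qed

text \<open>In the variable \<open>s = W x\<close> this says that the trapezoidal rule is exact for the derivative of
  \<open>w\<^sup>2\<close>, because \<open>d w / d x = w (d w / d s)\<close>. Only polynomials in \<open>s\<close> of degree at most two have this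
  property, so \<open>w'\<close> is an affine function of \<open>W\<close>, which is the differential equation for \<open>w\<close>.\<close>

lemma trapezoid_eq:
  assumes x: "x \<in> I" and y: "y \<in> I"
  shows "(W x - W y) * (deriv w x + deriv w y) = (w x)\<^sup>2 - (w y)\<^sup>2"
proof -
  let ?m = "(x + y) / 2"
  have m: "?m \<in> I" using midpoint_in[OF x y] .
  have "w ?m * ((W x - W y) * (deriv w x + deriv w y))
      = (deriv w ?m * (W x - W y)) * (w x + w y)"
    using deriv_w_midpoint_sum[OF x y] by (simp add: algebra_simps)
  also have "\<dots> = w ?m * ((w x)\<^sup>2 - (w y)\<^sup>2)"
    unfolding deriv_w_midpoint[OF x y] by (simp add: algebra_simps power2_eq_square)
  finally show ?thesis using w_nonzero[OF m] by simp
qed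

lemma w_ode:
  obtains \<mu> where "\<And>x. x \<in> I \<Longrightarrow> (deriv w has_real_derivative \<mu> * w x) (at x)"
proof (cases "I = {}")
  case False
  then obtain c where c: "c \<in> I" by blast
  obtain d where d: "d \<in> I" "d \<noteq> c" using other_point[OF c] .
  have ne: "W d - W c \<noteq> 0" using W_eq_iff[OF d(1) c] d(2) by simp
  define \<mu> where "\<mu> = (deriv w d - deriv w c) / (W d - W c)"
  define b where "b = deriv w c - \<mu> * W c"
  have affine: "\<mu> * W x + b = deriv w x" if x: "x \<in> I" for x
  proof -
    \<comment> \<open>Adding the trapezoid identities of the three pairs from \<open>x, c, d\<close> cancels the squares and
      leaves that the points \<open>(W t, w' t)\<close> for \<open>t = x, c, d\<close> are collinear.\<close>
    have "(W d - W c) * deriv w x + (W x - W d) * deriv w c + (W c - W x) * deriv w d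
        = (W x - W c) * (deriv w x + deriv w c) + (W c - W d) * (deriv w c + deriv w d)
            + (W d - W x) * (deriv w d + deriv w x)"
      by (simp add: algebra_simps)
    also have "\<dots> = 0"
      unfolding trapezoid_eq[OF x c] trapezoid_eq[OF c d(1)] trapezoid_eq[OF d(1) x] by simp
    finally have "(W d - W c) * deriv w x
        = (W d - W c) * deriv w c + (deriv w d - deriv w c) * (W x - W c)"
      by (simp add: algebra_simps)
    then have "deriv w x = deriv w c + \<mu> * (W x - W c)"
      using ne by (simp add: \<mu>_def field_simps)
    then show ?thesis by (simp add: b_def algebra_simps)
  qed
  have "(deriv w has_real_derivative \<mu> * w x) (at x)" if x: "x \<in> I" for x
  proof -
    have "((\<lambda>x. \<mu> * W x + b) has_real_derivative \<mu> * w x) (at x)"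
      using x by (auto intro!: derivative_eq_intros)
    then show ?thesis
      using has_field_derivative_transform_within_open[OF _ open_I x affine] by simp
  qed
  then show thesis by (rule that)
qed (use that in auto)

end

text \<open>Unless \<^term>\<open>\<phi>\<close> is constant, \<^term>\<open>w\<close> solves a linear equation of second order with constant
  coefficients, and \<^term>\<open>\<phi>\<close> is recovered from the constant Wronskian \<open>\<phi>' w\<^sup>2\<close> of \<^term>\<open>w\<close>
  and \<open>\<phi> w\<close>.\<close>

theorem (in weighted_midpoint) weighted_midpoint_cases:
  obtains (const) c where "\<And>x. x \<in> I \<Longrightarrow> \<phi> x = c"
  | (ode) \<mu> k w' where "k \<noteq> 0"
      "\<And>x. x \<in> I \<Longrightarrow> (w has_real_derivative w' x) (at x)"
      "\<And>x. x \<in> I \<Longrightarrow> (w' has_real_derivative \<mu> * w x) (at x)"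
      "\<And>x. x \<in> I \<Longrightarrow> (\<phi> has_real_derivative k / (w x)\<^sup>2) (at x)"
proof (cases "inj_on \<phi> I")
  case False
  then show thesis using \<phi>_constant_or_inj const by blast
next
  case True
  then interpret injective_weighted_midpoint I w \<phi> by unfold_locales
  obtain k where k: "k \<noteq> 0" "\<And>x. x \<in> I \<Longrightarrow> deriv \<phi> x * (w x)\<^sup>2 = k"
    using deriv_\<phi>_times_w_squared by blast
  obtain \<mu> where \<mu>: "\<And>x. x \<in> I \<Longrightarrow> (deriv w has_real_derivative \<mu> * w x) (at x)"
    using w_ode by blast
  have "(\<phi> has_real_derivative k / (w x)\<^sup>2) (at x)" if x: "x \<in> I" for x
  proof -
    have "k / (w x)\<^sup>2 = deriv \<phi> x" using k(2)[OF x] w_nonzero[OF x] by (auto simp: field_simps)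
    then show ?thesis using \<phi>_deriv[OF x] by simp
  qed
  then show thesis by (intro ode[of k "deriv w" \<mu>] k(1) w_deriv \<mu>)
qed

section \<open>Linear equations of second order with constant coefficients\<close>

lemma exp_combination_eq_sinh_cosh:
  fixes a b \<kappa> :: real
  assumes "a \<noteq> 0" "b \<noteq> 0"
  obtains (cosh) \<mu> \<delta> where "\<mu> \<noteq> 0" "\<And>x. a * exp (\<kappa> * x) + b * exp (- \<kappa> * x) = \<mu> * cosh (\<kappa> * x + \<delta>)"
  | (sinh) \<mu> \<delta> where "\<mu> \<noteq> 0" "\<And>x. a * exp (\<kappa> * x) + b * exp (- \<kappa> * x) = \<mu> * sinh (\<kappa> * x + \<delta>)"
proof -
  define \<delta> where "\<delta> = ln \<bar>a / b\<bar> / 2"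
  define \<mu> where "\<mu> = 2 * a * exp (- \<delta>)"
  have \<mu>: "\<mu> \<noteq> 0" using assms by (simp add: \<mu>_def)
  have a: "a = \<mu> * exp \<delta> / 2" by (simp add: \<mu>_def flip: exp_add)
  have "exp (- \<delta>) * exp (- \<delta>) = exp (- ln \<bar>a / b\<bar>)" by (simp add: \<delta>_def flip: exp_add)
  also have "\<dots> = \<bar>b\<bar> / \<bar>a\<bar>" using assms by (simp add: exp_minus)
  finally have *: "\<mu> * exp (- \<delta>) / 2 = a * \<bar>b\<bar> / \<bar>a\<bar>" by (simp add: \<mu>_def algebra_simps)
  show thesis
  proof (cases "a * b > 0")
    case True
    then have b: "b = \<mu> * exp (- \<delta>) / 2"
      unfolding * by (auto simp: zero_less_mult_iff abs_if)
    have "a * exp (\<kappa> * x) + b * exp (- \<kappa> * x) = \<mu> * cosh (\<kappa> * x + \<delta>)" for x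
      by (subst a, subst b) (simp add: cosh_field_def exp_add exp_diff exp_minus field_simps)
    then show thesis using \<mu> cosh by blast
  next
    case False
    then have b: "b = - (\<mu> * exp (- \<delta>) / 2)"
      unfolding * using assms by (auto simp: zero_less_mult_iff abs_if)
    have "a * exp (\<kappa> * x) + b * exp (- \<kappa> * x) = \<mu> * sinh (\<kappa> * x + \<delta>)" for x
      by (subst a, subst b) (simp add: sinh_field_def exp_add exp_diff exp_minus field_simps)
    then show thesis using \<mu> sinh by blast
  qed
qed

lemma sin_cos_combination_eq_sin:
  fixes a b \<kappa> :: real
  assumes "a \<noteq> 0 \<or> b \<noteq> 0"
  obtains \<mu> \<delta> where "\<mu> \<noteq> 0" "\<And>x. a * cos (\<kappa> * x) + b * sin (\<kappa> * x) = \<mu> * sin (\<kappa> * x + \<delta>)"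
proof -
  define \<mu> where "\<mu> = sqrt (a\<^sup>2 + b\<^sup>2)"
  have \<mu>2: "\<mu>\<^sup>2 = a\<^sup>2 + b\<^sup>2" by (simp add: \<mu>_def)
  have \<mu>: "\<mu> \<noteq> 0" using assms by (simp add: \<mu>_def sum_power2_eq_zero_iff)
  have "(b / \<mu>)\<^sup>2 + (a / \<mu>)\<^sup>2 = 1"
    using \<mu> by (simp add: power_divide \<mu>2[symmetric] field_simps)
  then obtain \<delta> where "b / \<mu> = cos \<delta>" "a / \<mu> = sin \<delta>" by (rule sincos_total_2pi)
  then have ab: "b = \<mu> * cos \<delta>" "a = \<mu> * sin \<delta>" using \<mu> by (auto simp: field_simps)
  then have "a * cos (\<kappa> * x) + b * sin (\<kappa> * x) = \<mu> * sin (\<kappa> * x + \<delta>)" for x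
    by (simp add: sin_add algebra_simps)
  then show thesis using \<mu> that by blast
qed

text \<open>The parameters are scaled in the way in which they enter the solution families.\<close>

lemma linear_ode2_cases:
  fixes w w' :: "real \<Rightarrow> real"
  assumes I: "is_interval I" "I \<noteq> {}"
    and ode: "\<forall>x\<in>I. (w has_real_derivative w' x) (at x)"
      "\<forall>x\<in>I. (w' has_real_derivative \<mu> * w x) (at x)"
    and w_nz: "\<forall>x\<in>I. w x \<noteq> 0"
  obtains
    (const) q where "q \<noteq> 0" "\<And>x. x \<in> I \<Longrightarrow> w x = q"
  | (affine) \<alpha> \<beta> where "\<alpha> \<noteq> 0" "\<And>x. x \<in> I \<Longrightarrow> w x = \<alpha> * x + \<beta>"
  | (exp) a \<alpha> where "a \<noteq> 0" "\<alpha> \<noteq> 0" "\<And>x. x \<in> I \<Longrightarrow> w x = a * exp (- \<alpha> * x)"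
  | (sin) a \<alpha> \<beta> where "a \<noteq> 0" "\<alpha> \<noteq> 0" "\<And>x. x \<in> I \<Longrightarrow> w x = a * sin (2 * \<alpha> * x + 2 * \<beta>)"
  | (sinh) a \<alpha> \<beta> where "a \<noteq> 0" "\<alpha> \<noteq> 0" "\<And>x. x \<in> I \<Longrightarrow> w x = a * sinh (2 * \<alpha> * x + 2 * \<beta>)"
  | (cosh) a \<alpha> \<beta> where "a \<noteq> 0" "\<alpha> \<noteq> 0" "\<And>x. x \<in> I \<Longrightarrow> w x = a * cosh (2 * \<alpha> * x + 2 * \<beta>)"
proof -
  have w: "\<And>x. x \<in> I \<Longrightarrow> (w has_real_derivative w' x) (at x)"
    and w': "\<And>x. x \<in> I \<Longrightarrow> (w' has_real_derivative \<mu> * w x) (at x)"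
    and nz: "\<And>x. x \<in> I \<Longrightarrow> w x \<noteq> 0"
    using ode w_nz by blast+
  note [derivative_intros] = DERIV_chain2[OF w] DERIV_chain2[OF w']
  have zero: "((\<lambda>x. 0) has_real_derivative 0) (at x)" for x :: real by simp
  obtain x\<^sub>0 where x\<^sub>0: "x\<^sub>0 \<in> I" using I(2) by blast
  consider "\<mu> = 0" | "\<mu> > 0" | "\<mu> < 0" by linarith
  then show thesis
  proof cases
    case 1
    have "(w' has_real_derivative 0) (at x)" if "x \<in> I" for x using w'[OF that] 1 by simp
    then obtain p where p: "\<And>x. x \<in> I \<Longrightarrow> w' x = 0 + p"
      using same_deriv_eq_plus_const[OF I(1) _ zero] by blast
    have "((\<lambda>x. p * x) has_real_derivative w' x) (at x)" if "x \<in> I" for x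
      using p[OF that] by (auto intro!: derivative_eq_intros)
    then obtain q where q: "\<And>x. x \<in> I \<Longrightarrow> w x = p * x + q"
      using same_deriv_eq_plus_const[OF I(1) w] by blast
    show thesis
    proof (cases "p = 0")
      case True
      then have "\<And>x. x \<in> I \<Longrightarrow> w x = q" using q by simp
      moreover from this have "q \<noteq> 0" using nz[OF x\<^sub>0] x\<^sub>0 by simp
      ultimately show thesis using const by blast
    qed (use q affine in blast)
  next
    case 2
    define \<kappa> where "\<kappa> = sqrt \<mu>"
    have \<kappa>: "\<kappa> > 0" "\<mu> = \<kappa> * \<kappa>" using 2 by (simp_all add: \<kappa>_def)
    \<comment> \<open>The operator factors as \<open>(d/dx - \<kappa>) (d/dx + \<kappa>)\<close>; each factor gives one constant.\<close>
    have "((\<lambda>x. (w' x + \<kappa> * w x) * exp (- \<kappa> * x)) has_real_derivative 0) (at x)" if "x \<in> I" for x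
      using that by (auto intro!: derivative_eq_intros simp: \<kappa>(2) algebra_simps)
    then obtain c where c: "\<And>x. x \<in> I \<Longrightarrow> (w' x + \<kappa> * w x) * exp (- \<kappa> * x) = 0 + c"
      using same_deriv_eq_plus_const[OF I(1) _ zero] by blast
    have "((\<lambda>x. (w' x - \<kappa> * w x) * exp (\<kappa> * x)) has_real_derivative 0) (at x)" if "x \<in> I" for x
      using that by (auto intro!: derivative_eq_intros simp: \<kappa>(2) algebra_simps)
    then obtain d where d: "\<And>x. x \<in> I \<Longrightarrow> (w' x - \<kappa> * w x) * exp (\<kappa> * x) = 0 + d"
      using same_deriv_eq_plus_const[OF I(1) _ zero] by blast
    define a where "a = c / (2 * \<kappa>)"
    define b where "b = - d / (2 * \<kappa>)"
    have w_eq: "w x = a * exp (\<kappa> * x) + b * exp (- \<kappa> * x)" if x: "x \<in> I" for x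
    proof -
      have "w' x + \<kappa> * w x = c * exp (\<kappa> * x)"
        using c[OF x] by (simp add: exp_minus field_simps)
      moreover have "w' x - \<kappa> * w x = d * exp (- \<kappa> * x)"
        using d[OF x] by (simp add: exp_minus field_simps)
      ultimately have "2 * \<kappa> * w x = c * exp (\<kappa> * x) - d * exp (- \<kappa> * x)" by linarith
      then show ?thesis using \<kappa>(1) by (simp add: a_def b_def field_simps)
    qed
    consider "a = 0" "b \<noteq> 0" | "a \<noteq> 0" "b = 0" | "a \<noteq> 0" "b \<noteq> 0"
      using w_eq[OF x\<^sub>0] nz[OF x\<^sub>0] by fastforce
    then show thesis
    proof cases
      case 1
      then show thesis using exp[of b \<kappa>] w_eq \<kappa>(1) by simp
    next
      case 2
      then show thesis using exp[of a "- \<kappa>"] w_eq \<kappa>(1) by simp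
    next
      case 3
      then show thesis
      proof (cases rule: exp_combination_eq_sinh_cosh[where \<kappa> = \<kappa>])
        case (cosh m \<delta>)
        show thesis
          by (rule \<open>\<And>a \<alpha> \<beta>. a \<noteq> 0 \<Longrightarrow> \<alpha> \<noteq> 0 \<Longrightarrow> (\<And>x. x \<in> I \<Longrightarrow> w x = a * cosh (2 * \<alpha> * x + 2 * \<beta>)) \<Longrightarrow> thesis\<close>
              [of m "\<kappa> / 2" "\<delta> / 2"])
             (use cosh w_eq \<kappa>(1) in auto)
      next
        case (sinh m \<delta>)
        show thesis
          by (rule \<open>\<And>a \<alpha> \<beta>. a \<noteq> 0 \<Longrightarrow> \<alpha> \<noteq> 0 \<Longrightarrow> (\<And>x. x \<in> I \<Longrightarrow> w x = a * sinh (2 * \<alpha> * x + 2 * \<beta>)) \<Longrightarrow> thesis\<close>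
              [of m "\<kappa> / 2" "\<delta> / 2"])
             (use sinh w_eq \<kappa>(1) in auto)
      qed
    qed
  next
    case 3
    define \<kappa> where "\<kappa> = sqrt (- \<mu>)"
    have \<kappa>: "\<kappa> > 0" "\<mu> = - (\<kappa> * \<kappa>)" using 3 by (simp_all add: \<kappa>_def)
    \<comment> \<open>The constants are the coefficients of \<open>cos (\<kappa> x)\<close> and \<open>sin (\<kappa> x)\<close>, multiplied by \<open>\<kappa>\<close>.\<close>
    have "((\<lambda>x. \<kappa> * w x * cos (\<kappa> * x) - w' x * sin (\<kappa> * x)) has_real_derivative 0) (at x)"
      if "x \<in> I" for x
      using that by (auto intro!: derivative_eq_intros simp: \<kappa>(2) algebra_simps)
    then obtain c where c: "\<And>x. x \<in> I \<Longrightarrow> \<kappa> * w x * cos (\<kappa> * x) - w' x * sin (\<kappa> * x) = 0 + c"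
      using same_deriv_eq_plus_const[OF I(1) _ zero] by blast
    have "((\<lambda>x. \<kappa> * w x * sin (\<kappa> * x) + w' x * cos (\<kappa> * x)) has_real_derivative 0) (at x)"
      if "x \<in> I" for x
      using that by (auto intro!: derivative_eq_intros simp: \<kappa>(2) algebra_simps)
    then obtain d where d: "\<And>x. x \<in> I \<Longrightarrow> \<kappa> * w x * sin (\<kappa> * x) + w' x * cos (\<kappa> * x) = 0 + d"
      using same_deriv_eq_plus_const[OF I(1) _ zero] by blast
    have w_eq: "w x = c / \<kappa> * cos (\<kappa> * x) + d / \<kappa> * sin (\<kappa> * x)" if x: "x \<in> I" for x
    proof -
      have "c * cos (\<kappa> * x) + d * sin (\<kappa> * x) = \<kappa> * w x * ((cos (\<kappa> * x))\<^sup>2 + (sin (\<kappa> * x))\<^sup>2)"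
        using c[OF x] d[OF x] by algebra
      then show ?thesis using \<kappa>(1) by (simp add: field_simps)
    qed
    have "c / \<kappa> \<noteq> 0 \<or> d / \<kappa> \<noteq> 0" using w_eq[OF x\<^sub>0] nz[OF x\<^sub>0] by auto
    then obtain m \<delta> where "m \<noteq> 0"
        "\<And>x. c / \<kappa> * cos (\<kappa> * x) + d / \<kappa> * sin (\<kappa> * x) = m * sin (\<kappa> * x + \<delta>)"
      using sin_cos_combination_eq_sin[where \<kappa> = \<kappa>] by blast
    then show thesis using sin[of m "\<kappa> / 2" "\<delta> / 2"] w_eq \<kappa>(1) by auto
  qed
qed

section \<open>The solution families\<close>

text \<open>A pair \<open>l\<close>, \<open>H\<close> determines \<open>G\<close> on the difference set.\<close>

lemma equation_iff_G:
  assumes "\<And>x y. x \<in> I \<Longrightarrow> y \<in> I \<Longrightarrow> g (l x - l y) = H ((x + y) / 2) - (H x + H y) / (2::real)"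
  shows "(\<forall>x\<in>I. \<forall>y\<in>I. G (l x - l y) = H ((x + y) / 2) - (H x + H y) / 2)
    \<longleftrightarrow> (\<forall>u\<in>diff_set l I. G u = g u)"
  using assms unfolding diff_set_def by fastforce

lemma ln_cosh_half_diff:
  fixes p q :: real
  assumes "p * q > 0"
  shows "ln (cosh ((ln \<bar>p\<bar> - ln \<bar>q\<bar>) / 2)) = ln \<bar>(p + q) / 2\<bar> - (ln \<bar>p\<bar> + ln \<bar>q\<bar>) / 2"
proof -
  define a b where "a = sqrt \<bar>p\<bar>" and "b = sqrt \<bar>q\<bar>"
  have pos: "a > 0" "b > 0" using assms by (auto simp: a_def b_def)
  have sq: "\<bar>p\<bar> = a\<^sup>2" "\<bar>q\<bar> = b\<^sup>2" by (simp_all add: a_def b_def)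
  have sum: "\<bar>(p + q) / 2\<bar> = (a\<^sup>2 + b\<^sup>2) / 2"
    using assms by (auto simp: zero_less_mult_iff simp flip: sq)
  have log: "(ln \<bar>p\<bar> - ln \<bar>q\<bar>) / 2 = ln (a / b)" "(ln \<bar>p\<bar> + ln \<bar>q\<bar>) / 2 = ln a + ln b"
    unfolding sq using pos by (simp_all add: ln_realpow ln_div)
  have "cosh (ln (a / b)) = ((a\<^sup>2 + b\<^sup>2) / 2) / (a * b)"
    using pos by (simp add: cosh_ln_real field_simps power2_eq_square)
  moreover have "ln (((a\<^sup>2 + b\<^sup>2) / 2) / (a * b)) = ln ((a\<^sup>2 + b\<^sup>2) / 2) - (ln a + ln b)"
    using pos by (simp add: ln_div ln_mult sum_power2_eq_zero_iff)
  ultimately show ?thesis unfolding log sum by simp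
qed

text \<open>This covers both \<open>s / c = tan a\<close> and \<open>s / c = tanh a\<close>, with \<open>2 s c\<close> equal to
  \<open>sin (2 a)\<close> and \<open>sinh (2 a)\<close> and \<open>s c' + c s'\<close> given by the addition theorems.\<close>

lemma ln_cosh_half_diff_quotients:
  fixes s c s' c' :: real
  assumes pos: "(2 * s * c) * (2 * s' * c') > 0"
  shows "ln (cosh ((ln \<bar>s / c\<bar> - ln \<bar>s' / c'\<bar>) / 2))
    = ln \<bar>s * c' + c * s'\<bar> - (ln \<bar>2 * s * c\<bar> + ln \<bar>2 * s' * c'\<bar>) / 2"
proof -
  have nz: "s \<noteq> 0" "c \<noteq> 0" "s' \<noteq> 0" "c' \<noteq> 0" using pos by auto
  have pq: "s / c * (s' / c') > 0"
    using pos nz by (auto simp: zero_less_mult_iff zero_less_divide_iff mult_less_0_iff divide_less_0_iff)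
  have eq: "(s / c + s' / c') / 2 = (s * c' + c * s') / (2 * c * c')"
    using nz by (simp add: field_simps)
  have "s / c + s' / c' \<noteq> 0"
  proof
    assume "s / c + s' / c' = 0"
    then have "s' / c' = - (s / c)" by linarith
    then have "s / c * (s' / c') = - (s / c)\<^sup>2" by (simp only: power2_eq_square mult_minus_right)
    then show False using pq zero_le_power2[of "s / c"] by linarith
  qed
  then have S: "s * c' + c * s' \<noteq> 0" using eq by auto
  have sum: "ln \<bar>(s / c + s' / c') / 2\<bar> = ln \<bar>s * c' + c * s'\<bar> - (ln 2 + ln \<bar>c\<bar> + ln \<bar>c'\<bar>)"
    unfolding eq using nz S by (simp add: abs_divide abs_mult ln_div ln_mult)
  show ?thesis
    using nz unfolding ln_cosh_half_diff[OF pq] sum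
    by (simp add: abs_divide abs_mult ln_div ln_mult add_divide_distrib diff_divide_distrib)
qed

lemma quadratic_identity:
  fixes l H :: "real \<Rightarrow> real"
  assumes "is_interval I" "D \<noteq> 0"
    and l: "\<forall>x\<in>I. l x = 1 / (2 * D) * x + E" and H: "\<forall>x\<in>I. H x = - C * x\<^sup>2 + A * x + B"
    and xy: "x \<in> I" "y \<in> I"
  shows "C * (D * (l x - l y))\<^sup>2 = H ((x + y) / 2) - (H x + H y) / 2"
proof -
  have m: "(x + y) / 2 \<in> I" using is_interval_midpoint assms by blast
  have D: "D * (l x - l y) = (x - y) / 2" using l xy \<open>D \<noteq> 0\<close> by (simp add: field_simps)
  have H_eqs: "H x = - C * x\<^sup>2 + A * x + B" "H y = - C * y\<^sup>2 + A * y + B"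
    "H ((x + y) / 2) = - C * ((x + y) / 2)\<^sup>2 + A * ((x + y) / 2) + B"
    using H xy m by blast+
  show ?thesis unfolding D H_eqs by (simp add: field_simps power2_eq_square)
qed

lemma exp_identity:
  fixes l H :: "real \<Rightarrow> real"
  assumes "is_interval I" "D \<noteq> 0"
    and l: "\<forall>x\<in>I. l x = 1 / (2 * D) * exp (\<alpha> * x) + E"
    and H: "\<forall>x\<in>I. H x = - (C / 2) * exp (2 * \<alpha> * x) + A * x + B"
    and xy: "x \<in> I" "y \<in> I"
  shows "C * (D * (l x - l y))\<^sup>2 = H ((x + y) / 2) - (H x + H y) / 2"
proof -
  have m: "(x + y) / 2 \<in> I" using is_interval_midpoint assms by blast
  define p q where "p = exp (\<alpha> * x)" and "q = exp (\<alpha> * y)"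
  have D: "D * (l x - l y) = (p - q) / 2"
    using l xy \<open>D \<noteq> 0\<close> by (simp add: p_def q_def field_simps)
  have "exp (2 * \<alpha> * x) = p\<^sup>2" "exp (2 * \<alpha> * y) = q\<^sup>2"
    "exp (2 * \<alpha> * ((x + y) / 2)) = p * q"
    by (simp_all add: p_def q_def algebra_simps flip: exp_add exp_double)
  then have H_eqs: "H x = - (C / 2) * p\<^sup>2 + A * x + B" "H y = - (C / 2) * q\<^sup>2 + A * y + B"
    "H ((x + y) / 2) = - (C / 2) * (p * q) + A * ((x + y) / 2) + B"
    using H xy m by simp_all
  show ?thesis unfolding D H_eqs by (simp add: field_simps power2_eq_square)
qed

text \<open>The affine part of \<^term>\<open>H\<close> does not contribute.\<close>

lemma midpoint_deviation_plus_affine: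
  fixes H K :: "real \<Rightarrow> real"
  assumes "is_interval I" and H: "\<forall>x\<in>I. H x = C * K x + A * x + B" and xy: "x \<in> I" "y \<in> I"
  shows "H ((x + y) / 2) - (H x + H y) / 2 = C * (K ((x + y) / 2) - (K x + K y) / 2)"
proof -
  have "(x + y) / 2 \<in> I" using is_interval_midpoint assms by blast
  then show ?thesis using H xy by (simp add: field_simps)
qed

lemma ln_identity:
  fixes l H :: "real \<Rightarrow> real"
  assumes I: "is_interval I" and "D \<noteq> 0"
    and l: "\<forall>x\<in>I. l x = 1 / (2 * D) * ln \<bar>\<alpha> * x + \<beta>\<bar> + E"
    and H: "\<forall>x\<in>I. H x = C * ln \<bar>\<alpha> * x + \<beta>\<bar> + A * x + B"
    and nz: "\<And>x. x \<in> I \<Longrightarrow> \<alpha> * x + \<beta> \<noteq> 0"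
    and xy: "x \<in> I" "y \<in> I"
  shows "C * ln (cosh (D * (l x - l y))) = H ((x + y) / 2) - (H x + H y) / 2"
proof -
  have pos: "(\<alpha> * x + \<beta>) * (\<alpha> * y + \<beta>) > 0"
    by (rule continuous_nonzero_same_sign[OF I _ nz xy]) (auto intro!: continuous_intros)
  have D: "D * (l x - l y) = (ln \<bar>\<alpha> * x + \<beta>\<bar> - ln \<bar>\<alpha> * y + \<beta>\<bar>) / 2"
    using l xy \<open>D \<noteq> 0\<close> by (simp add: field_simps)
  have m: "(\<alpha> * x + \<beta> + (\<alpha> * y + \<beta>)) / 2 = \<alpha> * ((x + y) / 2) + \<beta>" by (simp add: field_simps)
  show ?thesis
    unfolding midpoint_deviation_plus_affine[OF I H xy] D ln_cosh_half_diff[OF pos] m ..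
qed

lemma tan_identity:
  fixes l H :: "real \<Rightarrow> real"
  assumes I: "is_interval I" and "D \<noteq> 0"
    and l: "\<forall>x\<in>I. l x = 1 / (2 * D) * ln \<bar>tan (\<alpha> * x + \<beta>)\<bar> + E"
    and H: "\<forall>x\<in>I. H x = C * ln \<bar>sin (2 * \<alpha> * x + 2 * \<beta>)\<bar> + A * x + B"
    and nz: "\<And>x. x \<in> I \<Longrightarrow> sin (2 * \<alpha> * x + 2 * \<beta>) \<noteq> 0"
    and xy: "x \<in> I" "y \<in> I"
  shows "C * ln (cosh (D * (l x - l y))) = H ((x + y) / 2) - (H x + H y) / 2"
proof -
  define a b where "a = \<alpha> * x + \<beta>" and "b = \<alpha> * y + \<beta>"
  have dbl: "sin (2 * \<alpha> * x + 2 * \<beta>) = 2 * sin a * cos a"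
    "sin (2 * \<alpha> * y + 2 * \<beta>) = 2 * sin b * cos b"
    using sin_double[of a] sin_double[of b] by (simp_all add: a_def b_def algebra_simps)
  have "sin (2 * \<alpha> * x + 2 * \<beta>) * sin (2 * \<alpha> * y + 2 * \<beta>) > 0"
    by (rule continuous_nonzero_same_sign[OF I _ nz xy]) (auto intro!: continuous_intros)
  then have pos: "(2 * sin a * cos a) * (2 * sin b * cos b) > 0" by (simp only: dbl)
  have D: "D * (l x - l y) = (ln \<bar>sin a / cos a\<bar> - ln \<bar>sin b / cos b\<bar>) / 2"
    using l xy \<open>D \<noteq> 0\<close> by (simp add: a_def b_def tan_def field_simps)
  have "a + b = 2 * \<alpha> * ((x + y) / 2) + 2 * \<beta>" by (simp add: a_def b_def algebra_simps)
  then have m: "sin a * cos b + cos a * sin b = sin (2 * \<alpha> * ((x + y) / 2) + 2 * \<beta>)"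
    by (metis sin_add)
  show ?thesis
    unfolding midpoint_deviation_plus_affine[OF I H xy] D ln_cosh_half_diff_quotients[OF pos] m dbl ..
qed

lemma tanh_identity:
  fixes l H :: "real \<Rightarrow> real"
  assumes I: "is_interval I" and "D \<noteq> 0"
    and l: "\<forall>x\<in>I. l x = 1 / (2 * D) * ln \<bar>tanh (\<alpha> * x + \<beta>)\<bar> + E"
    and H: "\<forall>x\<in>I. H x = C * ln \<bar>sinh (2 * \<alpha> * x + 2 * \<beta>)\<bar> + A * x + B"
    and nz: "\<And>x. x \<in> I \<Longrightarrow> sinh (2 * \<alpha> * x + 2 * \<beta>) \<noteq> 0"
    and xy: "x \<in> I" "y \<in> I"
  shows "C * ln (cosh (D * (l x - l y))) = H ((x + y) / 2) - (H x + H y) / 2"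
proof -
  define a b where "a = \<alpha> * x + \<beta>" and "b = \<alpha> * y + \<beta>"
  have dbl: "sinh (2 * \<alpha> * x + 2 * \<beta>) = 2 * sinh a * cosh a"
    "sinh (2 * \<alpha> * y + 2 * \<beta>) = 2 * sinh b * cosh b"
    using sinh_double[of a] sinh_double[of b] by (simp_all add: a_def b_def algebra_simps)
  have "sinh (2 * \<alpha> * x + 2 * \<beta>) * sinh (2 * \<alpha> * y + 2 * \<beta>) > 0"
    by (rule continuous_nonzero_same_sign[OF I _ nz xy]) (auto intro!: continuous_intros)
  then have pos: "(2 * sinh a * cosh a) * (2 * sinh b * cosh b) > 0" by (simp only: dbl)
  have D: "D * (l x - l y) = (ln \<bar>sinh a / cosh a\<bar> - ln \<bar>sinh b / cosh b\<bar>) / 2"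
    using l xy \<open>D \<noteq> 0\<close> by (simp add: a_def b_def tanh_def field_simps)
  have "a + b = 2 * \<alpha> * ((x + y) / 2) + 2 * \<beta>" by (simp add: a_def b_def algebra_simps)
  then have m: "sinh a * cosh b + cosh a * sinh b = sinh (2 * \<alpha> * ((x + y) / 2) + 2 * \<beta>)"
    by (metis sinh_add)
  show ?thesis
    unfolding midpoint_deviation_plus_affine[OF I H xy] D ln_cosh_half_diff_quotients[OF pos] m dbl ..
qed

lemma cos_arctan_tanh_diff:
  "cos (arctan (tanh a) - arctan (tanh b)) = cosh (a + b) / sqrt (cosh (2 * a) * cosh (2 * b))"
  for a b :: real
proof -
  have sqrt: "sqrt (1 + (tanh t)\<^sup>2) = sqrt (cosh (2 * t)) / cosh t" for t :: real
  proof -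
    have "1 + (tanh t)\<^sup>2 = cosh (2 * t) / (cosh t)\<^sup>2"
      using cosh_double[of t] by (simp add: tanh_def power_divide field_simps)
    then show ?thesis by (simp add: real_sqrt_divide)
  qed
  have "cos (arctan (tanh a) - arctan (tanh b))
      = (1 + tanh a * tanh b) / (sqrt (1 + (tanh a)\<^sup>2) * sqrt (1 + (tanh b)\<^sup>2))"
    by (simp add: cos_diff cos_arctan sin_arctan add_divide_distrib)
  also have "1 + tanh a * tanh b = cosh (a + b) / (cosh a * cosh b)"
    by (simp add: tanh_def cosh_add field_simps)
  finally show ?thesis by (simp add: sqrt real_sqrt_mult)
qed

lemma arctan_identity:
  fixes l H :: "real \<Rightarrow> real"
  assumes I: "is_interval I" and "D \<noteq> 0"
    and l: "\<forall>x\<in>I. l x = 1 / D * arctan (tanh (\<alpha> * x + \<beta>)) + E"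
    and H: "\<forall>x\<in>I. H x = C * ln (cosh (2 * \<alpha> * x + 2 * \<beta>)) + A * x + B"
    and xy: "x \<in> I" "y \<in> I"
  shows "C * ln (cos (D * (l x - l y))) = H ((x + y) / 2) - (H x + H y) / 2"
proof -
  define a b where "a = \<alpha> * x + \<beta>" and "b = \<alpha> * y + \<beta>"
  have D: "D * (l x - l y) = arctan (tanh a) - arctan (tanh b)"
    using l xy \<open>D \<noteq> 0\<close> by (simp add: a_def b_def field_simps)
  have "ln (cos (D * (l x - l y)))
      = ln (cosh (a + b)) - (ln (cosh (2 * a)) + ln (cosh (2 * b))) / 2"
    unfolding D cos_arctan_tanh_diff
    by (simp add: ln_div ln_mult ln_sqrt)
  also have "a + b = 2 * \<alpha> * ((x + y) / 2) + 2 * \<beta>" by (simp add: a_def b_def algebra_simps)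
  also have "2 * a = 2 * \<alpha> * x + 2 * \<beta>" by (simp add: a_def)
  also have "2 * b = 2 * \<alpha> * y + 2 * \<beta>" by (simp add: b_def)
  finally show ?thesis unfolding midpoint_deviation_plus_affine[OF I H xy] by simp
qed

section \<open>The arguments of the logarithms do not vanish\<close>

lemma ln_argument_nonzero:
  fixes l t :: "real \<Rightarrow> real"
  assumes I: "open I" and x: "x \<in> I" and cont: "continuous_on I l" and "c \<noteq> 0"
    and l: "\<forall>x\<in>I. l x = 1 / c * ln \<bar>t x\<bar> + E"
    and t: "(t has_real_derivative d) (at x)" "d \<noteq> 0"
  shows "t x \<noteq> 0"
proof
  assume "t x = 0"
  have "isCont l x" using cont I x continuous_on_eq_continuous_at by blast
  then have "isCont (\<lambda>x. c * (l x - E)) x" by (intro continuous_intros)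
  moreover have "c * (l u - E) = ln \<bar>t u\<bar>" if "u \<in> I" for u
    using l that \<open>c \<noteq> 0\<close> by simp
  ultimately show False
    using ln_abs_simple_zero_not_continuous[OF I x _ _ t \<open>t x = 0\<close>] by blast
qed

lemma sol_ln_nonzero:
  assumes "open I" "continuous_on I l" and c: "C * D * \<alpha> \<noteq> 0"
    and sol: "sol_ln I G l H A B C D E \<alpha> \<beta>" and x: "x \<in> I"
  shows "\<alpha> * x + \<beta> \<noteq> 0"
  using c sol unfolding sol_ln_def
  by (intro ln_argument_nonzero[OF assms(1) x assms(2), where t = "\<lambda>x. \<alpha> * x + \<beta>"
        and c = "2 * D" and E = E and d = \<alpha>])
     (auto intro!: derivative_eq_intros)

lemma sol_tanh_nonzero:
  assumes "open I" "continuous_on I l" and c: "C * D * \<alpha> \<noteq> 0"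
    and sol: "sol_tanh I G l H A B C D E \<alpha> \<beta>" and x: "x \<in> I"
  shows "\<alpha> * x + \<beta> \<noteq> 0"
proof
  assume 0: "\<alpha> * x + \<beta> = 0"
  have "((\<lambda>x. tanh (\<alpha> * x + \<beta>)) has_real_derivative \<alpha>) (at x)"
    by (auto intro!: derivative_eq_intros simp: 0)
  then have "tanh (\<alpha> * x + \<beta>) \<noteq> 0"
    using c sol unfolding sol_tanh_def
    by (intro ln_argument_nonzero[OF assms(1) x assms(2), where t = "\<lambda>x. tanh (\<alpha> * x + \<beta>)"
          and c = "2 * D" and E = E and d = \<alpha>]) auto
  then show False using 0 by simp
qed

lemma sol_tan_nonzero:
  assumes "open I" "continuous_on I l" and c: "C * D * \<alpha> \<noteq> 0"
    and sol: "sol_tan I G l H A B C D E \<alpha> \<beta>" and x: "x \<in> I"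
  shows "sin (2 * \<alpha> * x + 2 * \<beta>) \<noteq> 0"
proof
  let ?a = "\<alpha> * x + \<beta>"
  assume "sin (2 * \<alpha> * x + 2 * \<beta>) = 0"
  moreover have "2 * \<alpha> * x + 2 * \<beta> = 2 * ?a" by simp
  ultimately have "sin ?a = 0 \<or> cos ?a = 0" by (simp only: sin_double) simp
  then show False
  proof
    assume 0: "sin ?a = 0"
    then have nz: "cos ?a \<noteq> 0" using sin_cos_squared_add[of ?a] by auto
    have "((\<lambda>x. tan (\<alpha> * x + \<beta>)) has_real_derivative \<alpha> * inverse ((cos ?a)\<^sup>2)) (at x)"
      using nz by (auto intro!: derivative_eq_intros simp: field_simps)
    then have "tan ?a \<noteq> 0"
      using c sol nz unfolding sol_tan_def
      by (intro ln_argument_nonzero[OF assms(1) x assms(2), where t = "\<lambda>x. tan (\<alpha> * x + \<beta>)"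
            and c = "2 * D" and E = E and d = "\<alpha> * inverse ((cos ?a)\<^sup>2)"]) auto
    then show False using 0 by (simp add: tan_def)
  next
    \<comment> \<open>At a pole of the tangent the roles are taken by the cotangent and \<open>- l\<close>.\<close>
    assume 0: "cos ?a = 0"
    then have nz: "sin ?a \<noteq> 0" using sin_cos_squared_add[of ?a] by auto
    have "((\<lambda>x. \<alpha> * x + \<beta>) has_real_derivative \<alpha>) (at x)"
      by (auto intro!: derivative_eq_intros)
    then have "((\<lambda>x. cot (\<alpha> * x + \<beta>)) has_real_derivative - \<alpha> * inverse ((sin ?a)\<^sup>2)) (at x)"
      using DERIV_chain2[where g = "\<lambda>x. \<alpha> * x + \<beta>" and x = x, OF DERIV_cot[OF nz]]
      by (simp add: mult.commute)
    moreover have "\<forall>u\<in>I. l u = 1 / (- 2 * D) * ln \<bar>cot (\<alpha> * u + \<beta>)\<bar> + E"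
      using sol unfolding sol_tan_def by (simp add: cot_altdef ln_inverse abs_inverse)
    ultimately have "cot ?a \<noteq> 0"
      using c nz by (intro ln_argument_nonzero[OF assms(1) x assms(2), where t = "\<lambda>x. cot (\<alpha> * x + \<beta>)"
            and c = "- 2 * D" and E = E and d = "- \<alpha> * inverse ((sin ?a)\<^sup>2)"]) auto
    then show False using 0 by (simp add: cot_def)
  qed
qed

section \<open>Integrating back\<close>

lemma DERIV_ln_abs:
  fixes f :: "real \<Rightarrow> real"
  assumes "(f has_real_derivative d) (at x)" "f x \<noteq> 0"
  shows "((\<lambda>x. ln \<bar>f x\<bar>) has_real_derivative d / f x) (at x)"
proof -
  have "ln \<bar>f t\<bar> = ln ((f t)\<^sup>2) / 2" for t
    by (metis ln_realpow nonzero_mult_div_cancel_left of_nat_numeral power2_abs zero_neq_numeral)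
  moreover have "((\<lambda>x. ln ((f x)\<^sup>2) / 2) has_real_derivative d / f x) (at x)"
    using assms by (auto intro!: derivative_eq_intros simp: power2_eq_square zero_less_mult_iff)
  ultimately show ?thesis by (simp only:)
qed

lemma same_second_deriv_eq_plus_affine:
  fixes H K \<phi> M h :: "real \<Rightarrow> real"
  assumes I: "is_interval I"
    and H: "\<And>x. x \<in> I \<Longrightarrow> (H has_real_derivative \<phi> x) (at x)"
    and \<phi>: "\<And>x. x \<in> I \<Longrightarrow> (\<phi> has_real_derivative h x) (at x)"
    and K: "\<And>x. x \<in> I \<Longrightarrow> (K has_real_derivative M x) (at x)"
    and M: "\<And>x. x \<in> I \<Longrightarrow> (M has_real_derivative h x) (at x)"
  obtains A B where "\<forall>x\<in>I. H x = K x + A * x + B"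
proof -
  obtain A where A: "\<And>x. x \<in> I \<Longrightarrow> \<phi> x = M x + A"
    using same_deriv_eq_plus_const[OF I \<phi> M] by blast
  have "((\<lambda>x. K x + A * x) has_real_derivative \<phi> x) (at x)" if "x \<in> I" for x
    using K[OF that] A[OF that] by (auto intro!: derivative_eq_intros)
  then obtain B where "\<And>x. x \<in> I \<Longrightarrow> H x = K x + A * x + B"
    using same_deriv_eq_plus_const[OF I H] by blast
  then show thesis using that by blast
qed

lemma one_minus_tanh_squared: "1 - (tanh t)\<^sup>2 = 1 / (cosh t)\<^sup>2" for t :: real
proof -
  have "1 - (tanh t)\<^sup>2 = ((cosh t)\<^sup>2 - (sinh t)\<^sup>2) / (cosh t)\<^sup>2"
    by (simp add: tanh_def power_divide diff_divide_distrib)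
  then show ?thesis by (simp add: hyperbolic_pythagoras)
qed

text \<open>Each possible \<^term>\<open>w\<close> determines \<^term>\<open>l\<close> up to a constant, \<^term>\<open>H\<close> up to an affine
  function, and then \<open>G\<close> by the identity of the corresponding family.\<close>

lemma nonconstant_solution_cases:
  fixes l H w \<phi> w' :: "real \<Rightarrow> real"
  assumes I: "is_interval I" "I \<noteq> {}" and k: "k \<noteq> 0"
    and l: "\<And>x. x \<in> I \<Longrightarrow> (l has_real_derivative 1 / w x) (at x)"
    and H: "\<And>x. x \<in> I \<Longrightarrow> (H has_real_derivative \<phi> x) (at x)"
    and w: "\<And>x. x \<in> I \<Longrightarrow> (w has_real_derivative w' x) (at x)"
    and w': "\<And>x. x \<in> I \<Longrightarrow> (w' has_real_derivative \<mu> * w x) (at x)"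
    and \<phi>: "\<And>x. x \<in> I \<Longrightarrow> (\<phi> has_real_derivative k / (w x)\<^sup>2) (at x)"
    and nz: "\<And>x. x \<in> I \<Longrightarrow> w x \<noteq> 0"
    and eq: "\<forall>x\<in>I. \<forall>y\<in>I. G (l x - l y) = H ((x + y) / 2) - (H x + H y) / 2"
  shows "\<exists>A B C D E \<alpha> \<beta>. C * D * \<alpha> \<noteq> 0 \<and>
    (sol_quadratic I G l H A B C D E
     \<or> sol_exp I G l H A B C D E \<alpha>
     \<or> sol_ln I G l H A B C D E \<alpha> \<beta>
     \<or> sol_tan I G l H A B C D E \<alpha> \<beta>
     \<or> sol_tanh I G l H A B C D E \<alpha> \<beta>
     \<or> sol_arctan I G l H A B C D E \<alpha> \<beta>)"
proof -
  have recover_l: "\<exists>E. \<forall>x\<in>I. l x = L x + E"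
    if L: "\<And>x. x \<in> I \<Longrightarrow> (L has_real_derivative 1 / w x) (at x)" for L
    using same_deriv_eq_plus_const[OF I(1) l L] by metis
  have recover_H: "\<exists>A B. \<forall>x\<in>I. H x = K x + A * x + B"
    if K: "\<And>x. x \<in> I \<Longrightarrow> (K has_real_derivative M x) (at x)"
      and M: "\<And>x. x \<in> I \<Longrightarrow> (M has_real_derivative k / (w x)\<^sup>2) (at x)" for K M
    using same_second_deriv_eq_plus_affine[OF I(1) H \<phi> K M] by metis
  have G: "\<forall>u\<in>diff_set l I. G u = g u"
    if "\<And>x y. x \<in> I \<Longrightarrow> y \<in> I \<Longrightarrow> g (l x - l y) = H ((x + y) / 2) - (H x + H y) / 2" for g
    using equation_iff_G[of I g l H G, OF that] eq by blast
  have ode: "\<forall>x\<in>I. (w has_real_derivative w' x) (at x)"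
    "\<forall>x\<in>I. (w' has_real_derivative \<mu> * w x) (at x)" "\<forall>x\<in>I. w x \<noteq> 0"
    using w w' nz by blast+
  from I ode show ?thesis
  proof (cases rule: linear_ode2_cases)
    case (const q)
    define C D where "C = - k / (2 * q\<^sup>2)" and "D = q / 2"
    have CD: "C \<noteq> 0" "D \<noteq> 0" using k const(1) by (auto simp: C_def D_def)
    have 0: "((\<lambda>x. 1 / (2 * D) * x) has_real_derivative 1 / w x) (at x)" if "x \<in> I" for x
      using const(1) const(2)[OF that] by (auto intro!: derivative_eq_intros simp: D_def)
    obtain E where l_eq: "\<forall>x\<in>I. l x = 1 / (2 * D) * x + E" using recover_l[OF 0] by blast
    have 1: "((\<lambda>x. - C * x\<^sup>2) has_real_derivative - 2 * C * x) (at x)" for x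
      by (auto intro!: derivative_eq_intros)
    have 2: "((\<lambda>x. - 2 * C * x) has_real_derivative k / (w x)\<^sup>2) (at x)" if "x \<in> I" for x
    proof -
      have "k / (w x)\<^sup>2 = - 2 * C" using const(2)[OF that] by (simp add: C_def)
      then show ?thesis by (auto intro!: derivative_eq_intros)
    qed
    obtain A B where H_eq: "\<forall>x\<in>I. H x = - C * x\<^sup>2 + A * x + B" using recover_H[OF 1 2] by blast
    have "\<forall>u\<in>diff_set l I. G u = C * (D * u)\<^sup>2"
      by (rule G, rule quadratic_identity[OF I(1) CD(2) l_eq H_eq]; assumption)
    then have "sol_quadratic I G l H A B C D E"
      unfolding sol_quadratic_def using l_eq H_eq by blast
    moreover have "C * D * 1 \<noteq> 0" using CD by simp
    ultimately show ?thesis by blast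
  next
    case (exp a \<alpha>)
    define C D where "C = - k / (2 * \<alpha>\<^sup>2 * a\<^sup>2)" and "D = a * \<alpha> / 2"
    have CD: "C \<noteq> 0" "D \<noteq> 0" using k exp(1,2) by (auto simp: C_def D_def)
    have 0: "((\<lambda>x. 1 / (2 * D) * exp (\<alpha> * x)) has_real_derivative 1 / w x) (at x)" if "x \<in> I" for x
    proof -
      have "1 / w x = exp (\<alpha> * x) / a"
        unfolding exp(3)[OF that] by (simp add: exp_minus divide_inverse)
      then show ?thesis
        using exp(1,2) by (auto intro!: derivative_eq_intros simp: D_def)
    qed
    obtain E where l_eq: "\<forall>x\<in>I. l x = 1 / (2 * D) * exp (\<alpha> * x) + E" using recover_l[OF 0] by blast
    have 1: "((\<lambda>x. - (C / 2) * exp (2 * \<alpha> * x)) has_real_derivative - C * \<alpha> * exp (2 * \<alpha> * x)) (at x)"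
      for x by (auto intro!: derivative_eq_intros)
    have 2: "((\<lambda>x. - C * \<alpha> * exp (2 * \<alpha> * x)) has_real_derivative k / (w x)\<^sup>2) (at x)"
      if "x \<in> I" for x
    proof -
      have "exp (2 * \<alpha> * x) = (exp (\<alpha> * x))\<^sup>2" by (simp add: mult.assoc flip: exp_double)
      then have "(w x)\<^sup>2 = a\<^sup>2 / exp (2 * \<alpha> * x)"
        using exp(3)[OF that]
        by (simp add: exp_minus power_mult_distrib power_inverse divide_inverse)
      then have "k / (w x)\<^sup>2 = - 2 * C * \<alpha>\<^sup>2 * exp (2 * \<alpha> * x)"
        using exp(1,2) by (simp add: C_def)
      then show ?thesis by (auto intro!: derivative_eq_intros simp: power2_eq_square)
    qed
    obtain A B where H_eq: "\<forall>x\<in>I. H x = - (C / 2) * exp (2 * \<alpha> * x) + A * x + B"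
      using recover_H[OF 1 2] by blast
    have "\<forall>u\<in>diff_set l I. G u = C * (D * u)\<^sup>2"
      by (rule G, rule exp_identity[OF I(1) CD(2) l_eq H_eq]; assumption)
    then have "sol_exp I G l H A B C D E \<alpha>"
      unfolding sol_exp_def using l_eq H_eq by blast
    moreover have "C * D * \<alpha> \<noteq> 0" using CD exp(2) by simp
    ultimately show ?thesis by blast
  next
    case (affine \<alpha> \<beta>)
    define C D where "C = - k / \<alpha>\<^sup>2" and "D = \<alpha> / 2"
    have CD: "C \<noteq> 0" "D \<noteq> 0" using k affine(1) by (auto simp: C_def D_def)
    have nz': "\<alpha> * x + \<beta> \<noteq> 0" if "x \<in> I" for x using nz affine(2) that by simp
    have ln: "((\<lambda>x. ln \<bar>\<alpha> * x + \<beta>\<bar>) has_real_derivative \<alpha> / (\<alpha> * x + \<beta>)) (at x)" if "x \<in> I" for x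
      by (rule DERIV_ln_abs) (use nz'[OF that] in \<open>auto intro!: derivative_eq_intros\<close>)
    have 0: "((\<lambda>x. 1 / (2 * D) * ln \<bar>\<alpha> * x + \<beta>\<bar>) has_real_derivative 1 / w x) (at x)" if "x \<in> I" for x
      by (rule DERIV_cong[OF DERIV_cmult[OF ln[OF that]]])
         (use affine(1) affine(2)[OF that] in \<open>simp add: D_def\<close>)
    obtain E where l_eq: "\<forall>x\<in>I. l x = 1 / (2 * D) * ln \<bar>\<alpha> * x + \<beta>\<bar> + E" using recover_l[OF 0] by blast
    have 1: "((\<lambda>x. C * ln \<bar>\<alpha> * x + \<beta>\<bar>) has_real_derivative C * (\<alpha> / (\<alpha> * x + \<beta>))) (at x)"
      if "x \<in> I" for x using DERIV_cmult[OF ln[OF that]] .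
    have 2: "((\<lambda>x. C * (\<alpha> / (\<alpha> * x + \<beta>))) has_real_derivative k / (w x)\<^sup>2) (at x)" if "x \<in> I" for x
      using affine(1) affine(2)[OF that] nz'[OF that]
      by (auto intro!: derivative_eq_intros simp: C_def power2_eq_square)
    obtain A B where H_eq: "\<forall>x\<in>I. H x = C * ln \<bar>\<alpha> * x + \<beta>\<bar> + A * x + B"
      using recover_H[OF 1 2] by blast
    have "\<forall>u\<in>diff_set l I. G u = C * ln (cosh (D * u))"
      by (rule G, rule ln_identity[OF I(1) CD(2) l_eq H_eq nz']; assumption)
    then have "sol_ln I G l H A B C D E \<alpha> \<beta>"
      unfolding sol_ln_def using l_eq H_eq by blast
    moreover have "C * D * \<alpha> \<noteq> 0" using CD affine(1) by simp
    ultimately show ?thesis by blast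
  next
    case (sin a \<alpha> \<beta>)
    define C D where "C = - k / (4 * \<alpha>\<^sup>2 * a\<^sup>2)" and "D = \<alpha> * a"
    have CD: "C \<noteq> 0" "D \<noteq> 0" using k sin(1,2) by (auto simp: C_def D_def)
    have nz': "sin (2 * \<alpha> * x + 2 * \<beta>) \<noteq> 0" if "x \<in> I" for x using nz sin(3) that by simp
    have dbl: "sin (2 * \<alpha> * x + 2 * \<beta>) = 2 * sin (\<alpha> * x + \<beta>) * cos (\<alpha> * x + \<beta>)" for x
      using sin_double[of "\<alpha> * x + \<beta>"] by (simp add: algebra_simps)
    have 0: "((\<lambda>x. 1 / (2 * D) * ln \<bar>tan (\<alpha> * x + \<beta>)\<bar>) has_real_derivative 1 / w x) (at x)"
      if x: "x \<in> I" for x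
    proof -
      have sc: "sin (\<alpha> * x + \<beta>) \<noteq> 0" "cos (\<alpha> * x + \<beta>) \<noteq> 0" using nz'[OF x] dbl by auto
      have "((\<lambda>x. tan (\<alpha> * x + \<beta>)) has_real_derivative \<alpha> / (cos (\<alpha> * x + \<beta>))\<^sup>2) (at x)"
        using sc by (auto intro!: derivative_eq_intros simp: field_simps)
      from DERIV_ln_abs[OF this]
      have "((\<lambda>x. ln \<bar>tan (\<alpha> * x + \<beta>)\<bar>) has_real_derivative
          \<alpha> / (cos (\<alpha> * x + \<beta>))\<^sup>2 / tan (\<alpha> * x + \<beta>)) (at x)" using sc by (simp add: tan_def)
      from DERIV_cmult[OF this, of "1 / (2 * D)"] show ?thesis
        by (rule DERIV_cong)
           (use sc sin(1,2) sin(3)[OF x] in \<open>simp add: dbl D_def tan_def power2_eq_square\<close>)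
    qed
    obtain E where l_eq: "\<forall>x\<in>I. l x = 1 / (2 * D) * ln \<bar>tan (\<alpha> * x + \<beta>)\<bar> + E"
      using recover_l[OF 0] by blast
    have 1: "((\<lambda>x. C * ln \<bar>sin (2 * \<alpha> * x + 2 * \<beta>)\<bar>) has_real_derivative
        C * (2 * \<alpha> * cos (2 * \<alpha> * x + 2 * \<beta>) / sin (2 * \<alpha> * x + 2 * \<beta>))) (at x)" if "x \<in> I" for x
      by (intro DERIV_cmult DERIV_ln_abs nz' that) (auto intro!: derivative_eq_intros)
    have 2: "((\<lambda>x. C * (2 * \<alpha> * cos (2 * \<alpha> * x + 2 * \<beta>) / sin (2 * \<alpha> * x + 2 * \<beta>)))
        has_real_derivative k / (w x)\<^sup>2) (at x)" if x: "x \<in> I" for x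
    proof -
      define s c where "s = sin (2 * \<alpha> * x + 2 * \<beta>)" and "c = cos (2 * \<alpha> * x + 2 * \<beta>)"
      have sc: "s\<^sup>2 + c\<^sup>2 = 1" "s \<noteq> 0" using nz'[OF x] by (simp_all add: s_def c_def)
      have "((\<lambda>x. C * (2 * \<alpha> * cos (2 * \<alpha> * x + 2 * \<beta>) / sin (2 * \<alpha> * x + 2 * \<beta>)))
          has_real_derivative C * (- (4 * \<alpha>\<^sup>2 * (s\<^sup>2 + c\<^sup>2)) / s\<^sup>2)) (at x)"
        using sc(2) unfolding s_def c_def
        by (auto intro!: derivative_eq_intros simp: power2_eq_square algebra_simps
            simp del: sin_cos_squared_add sin_cos_squared_add2 sin_cos_squared_add3)
      also have "C * (- (4 * \<alpha>\<^sup>2 * (s\<^sup>2 + c\<^sup>2)) / s\<^sup>2) = k / (w x)\<^sup>2"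
        unfolding sc(1) using sin(1,2) sin(3)[OF x] sc(2)
        by (simp add: C_def power_mult_distrib flip: s_def)
      finally show ?thesis .
    qed
    obtain A B where H_eq: "\<forall>x\<in>I. H x = C * ln \<bar>sin (2 * \<alpha> * x + 2 * \<beta>)\<bar> + A * x + B"
      using recover_H[OF 1 2] by blast
    have "\<forall>u\<in>diff_set l I. G u = C * ln (cosh (D * u))"
      by (rule G, rule tan_identity[OF I(1) CD(2) l_eq H_eq nz']; assumption)
    then have "sol_tan I G l H A B C D E \<alpha> \<beta>"
      unfolding sol_tan_def using l_eq H_eq by blast
    moreover have "C * D * \<alpha> \<noteq> 0" using CD sin(2) by simp
    ultimately show ?thesis by blast
  next
    case (sinh a \<alpha> \<beta>)
    define C D where "C = - k / (4 * \<alpha>\<^sup>2 * a\<^sup>2)" and "D = \<alpha> * a"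
    have CD: "C \<noteq> 0" "D \<noteq> 0" using k sinh(1,2) by (auto simp: C_def D_def)
    have nz': "sinh (2 * \<alpha> * x + 2 * \<beta>) \<noteq> 0" if "x \<in> I" for x using nz sinh(3) that by force
    have dbl: "sinh (2 * \<alpha> * x + 2 * \<beta>) = 2 * sinh (\<alpha> * x + \<beta>) * cosh (\<alpha> * x + \<beta>)" for x
      using sinh_double[of "\<alpha> * x + \<beta>"] by (simp add: algebra_simps)
    have 0: "((\<lambda>x. 1 / (2 * D) * ln \<bar>tanh (\<alpha> * x + \<beta>)\<bar>) has_real_derivative 1 / w x) (at x)"
      if x: "x \<in> I" for x
    proof -
      have s: "sinh (\<alpha> * x + \<beta>) \<noteq> 0" using nz'[OF x] unfolding dbl by force
      have "((\<lambda>x. tanh (\<alpha> * x + \<beta>)) has_real_derivative \<alpha> / (cosh (\<alpha> * x + \<beta>))\<^sup>2) (at x)"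
        by (auto intro!: derivative_eq_intros simp: one_minus_tanh_squared)
      from DERIV_ln_abs[OF this]
      have "((\<lambda>x. ln \<bar>tanh (\<alpha> * x + \<beta>)\<bar>) has_real_derivative
          \<alpha> / (cosh (\<alpha> * x + \<beta>))\<^sup>2 / tanh (\<alpha> * x + \<beta>)) (at x)" using s by (simp add: tanh_def)
      from DERIV_cmult[OF this, of "1 / (2 * D)"] show ?thesis
        by (rule DERIV_cong)
           (use s sinh(1,2) sinh(3)[OF x] in \<open>simp add: dbl D_def tanh_def power2_eq_square\<close>)
    qed
    obtain E where l_eq: "\<forall>x\<in>I. l x = 1 / (2 * D) * ln \<bar>tanh (\<alpha> * x + \<beta>)\<bar> + E"
      using recover_l[OF 0] by blast
    have 1: "((\<lambda>x. C * ln \<bar>sinh (2 * \<alpha> * x + 2 * \<beta>)\<bar>) has_real_derivative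
        C * (2 * \<alpha> * cosh (2 * \<alpha> * x + 2 * \<beta>) / sinh (2 * \<alpha> * x + 2 * \<beta>))) (at x)" if "x \<in> I" for x
      by (intro DERIV_cmult DERIV_ln_abs nz' that) (auto intro!: derivative_eq_intros)
    have 2: "((\<lambda>x. C * (2 * \<alpha> * cosh (2 * \<alpha> * x + 2 * \<beta>) / sinh (2 * \<alpha> * x + 2 * \<beta>)))
        has_real_derivative k / (w x)\<^sup>2) (at x)" if x: "x \<in> I" for x
    proof -
      define s c where "s = sinh (2 * \<alpha> * x + 2 * \<beta>)" and "c = cosh (2 * \<alpha> * x + 2 * \<beta>)"
      have sc: "c\<^sup>2 - s\<^sup>2 = 1" "s \<noteq> 0" using nz'[OF x] by (simp_all add: s_def c_def cosh_square_eq)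
      have "((\<lambda>x. C * (2 * \<alpha> * cosh (2 * \<alpha> * x + 2 * \<beta>) / sinh (2 * \<alpha> * x + 2 * \<beta>)))
          has_real_derivative C * (- (4 * \<alpha>\<^sup>2 * (c\<^sup>2 - s\<^sup>2)) / s\<^sup>2)) (at x)"
        using sc(2) unfolding s_def c_def
        by (auto intro!: derivative_eq_intros simp: power2_eq_square algebra_simps)
      also have "C * (- (4 * \<alpha>\<^sup>2 * (c\<^sup>2 - s\<^sup>2)) / s\<^sup>2) = k / (w x)\<^sup>2"
        unfolding sc(1) using sinh(1,2) sinh(3)[OF x] sc(2)
        by (simp add: C_def power_mult_distrib flip: s_def)
      finally show ?thesis .
    qed
    obtain A B where H_eq: "\<forall>x\<in>I. H x = C * ln \<bar>sinh (2 * \<alpha> * x + 2 * \<beta>)\<bar> + A * x + B"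
      using recover_H[OF 1 2] by blast
    have "\<forall>u\<in>diff_set l I. G u = C * ln (cosh (D * u))"
      by (rule G, rule tanh_identity[OF I(1) CD(2) l_eq H_eq nz']; assumption)
    then have "sol_tanh I G l H A B C D E \<alpha> \<beta>"
      unfolding sol_tanh_def using l_eq H_eq by blast
    moreover have "C * D * \<alpha> \<noteq> 0" using CD sinh(2) by simp
    ultimately show ?thesis by blast
  next
    case (cosh a \<alpha> \<beta>)
    define C D where "C = k / (4 * \<alpha>\<^sup>2 * a\<^sup>2)" and "D = \<alpha> * a"
    have CD: "C \<noteq> 0" "D \<noteq> 0" using k cosh(1,2) by (auto simp: C_def D_def)
    have 0: "((\<lambda>x. 1 / D * arctan (tanh (\<alpha> * x + \<beta>))) has_real_derivative 1 / w x) (at x)"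
      if x: "x \<in> I" for x
    proof -
      define s c where "s = sinh (\<alpha> * x + \<beta>)" and "c = cosh (\<alpha> * x + \<beta>)"
      have sc: "c\<^sup>2 - s\<^sup>2 = 1" "c > 0" by (simp_all add: s_def c_def cosh_square_eq)
      have t: "tanh (\<alpha> * x + \<beta>) = s / c" by (simp add: tanh_def s_def c_def)
      have wx: "w x = a * (c\<^sup>2 + s\<^sup>2)"
        using cosh(3)[OF x] cosh_double[of "\<alpha> * x + \<beta>"] by (simp add: s_def c_def algebra_simps)
      have pos: "c\<^sup>2 + s\<^sup>2 > 0" using sc(2) by (simp add: add_pos_nonneg)
      have "((\<lambda>x. arctan (tanh (\<alpha> * x + \<beta>))) has_real_derivative
          inverse (1 + (s / c)\<^sup>2) * ((1 - (s / c)\<^sup>2) * \<alpha>)) (at x)"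
        by (auto intro!: derivative_eq_intros simp: t)
      also have "inverse (1 + (s / c)\<^sup>2) * ((1 - (s / c)\<^sup>2) * \<alpha>) = (c\<^sup>2 - s\<^sup>2) / (c\<^sup>2 + s\<^sup>2) * \<alpha>"
      proof -
        have "1 + (s / c)\<^sup>2 = (c\<^sup>2 + s\<^sup>2) / c\<^sup>2" "1 - (s / c)\<^sup>2 = (c\<^sup>2 - s\<^sup>2) / c\<^sup>2"
          using sc(2) by (simp_all add: power_divide add_divide_distrib diff_divide_distrib)
        then show ?thesis using sc(2) by (simp add: inverse_eq_divide)
      qed
      finally have "((\<lambda>x. arctan (tanh (\<alpha> * x + \<beta>))) has_real_derivative \<alpha> / (c\<^sup>2 + s\<^sup>2)) (at x)"
        unfolding sc(1) by simp
      from DERIV_cmult[OF this, of "1 / D"] show ?thesis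
        by (rule DERIV_cong) (use cosh(1,2) in \<open>simp add: wx D_def\<close>)
    qed
    obtain E where l_eq: "\<forall>x\<in>I. l x = 1 / D * arctan (tanh (\<alpha> * x + \<beta>)) + E"
      using recover_l[OF 0] by blast
    have 1: "((\<lambda>x. C * ln (cosh (2 * \<alpha> * x + 2 * \<beta>))) has_real_derivative
        C * (2 * \<alpha> * tanh (2 * \<alpha> * x + 2 * \<beta>))) (at x)" for x
      by (auto intro!: derivative_eq_intros simp: tanh_def)
    have 2: "((\<lambda>x. C * (2 * \<alpha> * tanh (2 * \<alpha> * x + 2 * \<beta>)))
        has_real_derivative k / (w x)\<^sup>2) (at x)" if x: "x \<in> I" for x
    proof -
      have "C * (2 * \<alpha> * ((1 - (tanh (2 * \<alpha> * x + 2 * \<beta>))\<^sup>2) * (2 * \<alpha>))) = k / (w x)\<^sup>2"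
        using cosh(1,2) cosh(3)[OF x] unfolding one_minus_tanh_squared
        by (simp add: C_def power2_eq_square)
      moreover have "((\<lambda>x. C * (2 * \<alpha> * tanh (2 * \<alpha> * x + 2 * \<beta>))) has_real_derivative
          C * (2 * \<alpha> * ((1 - (tanh (2 * \<alpha> * x + 2 * \<beta>))\<^sup>2) * (2 * \<alpha>)))) (at x)"
        by (auto intro!: derivative_eq_intros)
      ultimately show ?thesis by simp
    qed
    obtain A B where H_eq: "\<forall>x\<in>I. H x = C * ln (cosh (2 * \<alpha> * x + 2 * \<beta>)) + A * x + B"
      using recover_H[OF 1 2] by blast
    have "\<forall>u\<in>diff_set l I. G u = C * ln (cos (D * u))"
      by (rule G, rule arctan_identity[OF I(1) CD(2) l_eq H_eq]; assumption)
    then have "sol_arctan I G l H A B C D E \<alpha> \<beta>"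
      unfolding sol_arctan_def using l_eq H_eq by blast
    moreover have "C * D * \<alpha> \<noteq> 0" using CD cosh(2) by simp
    ultimately show ?thesis by blast
  qed
qed

section \<open>The classification\<close>

text \<open>The partial derivatives of the equation with respect to \<open>x\<close> and \<open>y\<close> contain the same value
  of \<open>G'\<close>, which is eliminated. The derivative of \<open>G\<close> is taken within the difference set, which
  is all that the chain rule needs.\<close>

lemma imp_weighted_midpoint:
  assumes I: "open I" "is_interval I"
    and l: "\<And>x. x \<in> I \<Longrightarrow> (l has_real_derivative l' x) (at x)"
    and H: "\<And>x. x \<in> I \<Longrightarrow> (H has_real_derivative H' x) (at x)"
    and G: "G differentiable_on (diff_set l I)"
    and nz: "\<And>x. x \<in> I \<Longrightarrow> l' x \<noteq> 0"
    and cont: "continuous_on I H'"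
    and eq: "\<forall>x\<in>I. \<forall>y\<in>I. G (l x - l y) = H ((x + y) / 2) - (H x + H y) / 2"
  shows "weighted_midpoint I (\<lambda>x. 1 / l' x) H'"
proof
  show "open I" "is_interval I" "continuous_on I H'" by fact+
  fix x y assume xy: "x \<in> I" "y \<in> I"
  show "1 / l' x * (1 / l' y) > 0"
    using deriv_nonzero_same_sign[OF I(2) l nz xy] by simp
  have m: "(x + y) / 2 \<in> I" using is_interval_midpoint[OF I(2) xy] .
  have "l x - l y \<in> diff_set l I" using xy by (auto simp: diff_set_def)
  then obtain D where D: "(G has_real_derivative D) (at (l x - l y) within diff_set l I)"
    using G real_differentiableE unfolding differentiable_on_def by blast
  note [derivative_intros] = DERIV_chain2[OF H]
  have within: "at t within I = at t" if "t \<in> I" for t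
    using at_within_open[OF that I(1)] .
  have 1: "D * l' x = H' ((x + y) / 2) / 2 - H' x / 2"
  proof -
    have "((\<lambda>s. l s - l y) has_real_derivative l' x) (at x within I)"
      using l[OF xy(1)] by (auto intro!: derivative_eq_intros simp: within xy)
    moreover have "(G has_real_derivative D) (at (l x - l y) within (\<lambda>s. l s - l y) ` I)"
      by (rule has_field_derivative_subset[OF D]) (use xy in \<open>auto simp: diff_set_def\<close>)
    ultimately have "((\<lambda>s. G (l s - l y)) has_real_derivative D * l' x) (at x)"
      using DERIV_image_chain[of G D "\<lambda>s. l s - l y" x I "l' x"] by (simp add: within xy o_def)
    moreover have "((\<lambda>s. H ((s + y) / 2) - (H s + H y) / 2) has_real_derivative
        H' ((x + y) / 2) / 2 - H' x / 2) (at x)"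
      using xy m by (auto intro!: derivative_eq_intros)
    ultimately show ?thesis
      by (rule DERIV_unique_on[OF _ _ I(1) xy(1)]) (use eq xy in blast)
  qed
  have 2: "- D * l' y = H' ((x + y) / 2) / 2 - H' y / 2"
  proof -
    have "((\<lambda>s. l x - l s) has_real_derivative - l' y) (at y within I)"
      using l[OF xy(2)] by (auto intro!: derivative_eq_intros simp: within xy)
    moreover have "(G has_real_derivative D) (at (l x - l y) within (\<lambda>s. l x - l s) ` I)"
      by (rule has_field_derivative_subset[OF D]) (use xy in \<open>auto simp: diff_set_def\<close>)
    ultimately have "((\<lambda>s. G (l x - l s)) has_real_derivative - D * l' y) (at y)"
      using DERIV_image_chain[of G D "\<lambda>s. l x - l s" y I "- l' y"] by (simp add: within xy o_def)
    moreover have "((\<lambda>s. H ((x + s) / 2) - (H x + H s) / 2) has_real_derivative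
        H' ((x + y) / 2) / 2 - H' y / 2) (at y)"
      using xy m by (auto intro!: derivative_eq_intros)
    ultimately show ?thesis
      by (rule DERIV_unique_on[OF _ _ I(1) xy(2)]) (use eq xy in blast)
  qed
  have "1 / l' x * (H' ((x + y) / 2) - H' x) = 2 * D"
    using 1 nz[OF xy(1)] by (simp add: field_simps)
  moreover have "1 / l' y * (H' y - H' ((x + y) / 2)) = 2 * D"
    using 2 nz[OF xy(2)] by (simp add: field_simps)
  ultimately show "1 / l' x * (H' ((x + y) / 2) - H' x) = 1 / l' y * (H' y - H' ((x + y) / 2))"
    by simp
qed

theorem theorem15:
  fixes I :: "real set" and G\<^sub>0 l H :: "real \<Rightarrow> real"
  assumes "open I" and "is_interval I" and "I \<noteq> {}"
    and "l differentiable_on I"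
    and "H differentiable_on I"
    and "G\<^sub>0 differentiable_on (diff_set l I)"
    and "\<forall>x \<in> I. deriv l x \<noteq> 0"
    and "continuous_on I (deriv H)"
  shows
    "((\<forall>x \<in> I. \<forall>y \<in> I. G\<^sub>0 (l x - l y) = H ((x + y) / 2) - (H x + H y) / 2)
      \<longleftrightarrow>
      (\<exists>A B C D E \<alpha> \<beta> :: real. C * D * \<alpha> \<noteq> 0 \<and>
         (sol_trivial I G\<^sub>0 l H A B
          \<or> sol_quadratic I G\<^sub>0 l H A B C D E
          \<or> sol_exp I G\<^sub>0 l H A B C D E \<alpha>
          \<or> sol_ln I G\<^sub>0 l H A B C D E \<alpha> \<beta>
          \<or> sol_tan I G\<^sub>0 l H A B C D E \<alpha> \<beta>
          \<or> sol_tanh I G\<^sub>0 l H A B C D E \<alpha> \<beta>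
          \<or> sol_arctan I G\<^sub>0 l H A B C D E \<alpha> \<beta>)))
     \<and>
     (\<forall>A B C D E \<alpha> \<beta> :: real. C * D * \<alpha> \<noteq> 0 \<longrightarrow>
         (sol_ln I G\<^sub>0 l H A B C D E \<alpha> \<beta> \<longrightarrow> 0 \<notin> affine_image \<alpha> \<beta> I)
         \<and> (sol_tan I G\<^sub>0 l H A B C D E \<alpha> \<beta> \<longrightarrow>
              \<int> \<inter> (\<lambda>t. 2 / pi * t) ` affine_image \<alpha> \<beta> I = {})
         \<and> (sol_tanh I G\<^sub>0 l H A B C D E \<alpha> \<beta> \<longrightarrow> 0 \<notin> affine_image \<alpha> \<beta> I))"
  (is "(?eq \<longleftrightarrow> ?sol) \<and> ?side")
proof -
  have deriv_at: "(f has_real_derivative deriv f x) (at x)"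
    if f: "f differentiable_on I" and x: "x \<in> I" for f :: "real \<Rightarrow> real" and x
  proof -
    have "f differentiable at x"
      using differentiable_on_eq_differentiable_at[OF assms(1)] f x by blast
    then show ?thesis by (metis DERIV_imp_deriv real_differentiable_def)
  qed
  note l = deriv_at[OF assms(4)] and H = deriv_at[OF assms(5)]
  have cont_l: "continuous_on I l" using assms(4) by (rule differentiable_imp_continuous_on)
  have "?eq \<Longrightarrow> ?sol"
  proof -
    assume eq: ?eq
    let ?w = "\<lambda>x. 1 / deriv l x"
    interpret weighted_midpoint I ?w "deriv H"
      by (rule imp_weighted_midpoint[OF assms(1,2) l H assms(6) _ assms(8) eq]) (use assms(7) in auto)
    show ?sol
    proof (cases rule: weighted_midpoint_cases)
      case (const A)
      have "((\<lambda>x. A * x) has_real_derivative deriv H x) (at x)" if "x \<in> I" for x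
        using const[OF that] by (auto intro!: derivative_eq_intros)
      then obtain B where B: "\<And>x. x \<in> I \<Longrightarrow> H x = A * x + B"
        using same_deriv_eq_plus_const[OF assms(2) H] by metis
      have "0 = H ((x + y) / 2) - (H x + H y) / 2" if "x \<in> I" "y \<in> I" for x y
        using B[OF that(1)] B[OF that(2)] B[OF midpoint_in[OF that]] by (simp add: field_simps)
      then have "\<forall>u\<in>diff_set l I. G\<^sub>0 u = 0"
        using equation_iff_G[of I "\<lambda>u. 0" l H G\<^sub>0] eq by blast
      then have "sol_trivial I G\<^sub>0 l H A B" unfolding sol_trivial_def using B by blast
      \<comment> \<open>\<open>C\<close>, \<open>D\<close> and \<open>\<alpha>\<close> do not occur in this family and are only required to be nonzero.\<close>
      moreover have "1 * 1 * 1 \<noteq> (0::real)" by simp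
      ultimately show ?sol by blast
    next
      case (ode \<mu> k w')
      have l': "(l has_real_derivative 1 / ?w x) (at x)" if "x \<in> I" for x
        using l[OF that] by simp
      show ?sol
        using nonconstant_solution_cases[OF assms(2,3) ode(1) l' H ode(2,3,4) w_nonzero eq] by blast
    qed
  qed
  moreover have "?sol \<Longrightarrow> ?eq"
  proof -
    assume ?sol
    then obtain A B C D E \<alpha> \<beta> where c: "C * D * \<alpha> \<noteq> 0"
      and sol: "sol_trivial I G\<^sub>0 l H A B
          \<or> sol_quadratic I G\<^sub>0 l H A B C D E
          \<or> sol_exp I G\<^sub>0 l H A B C D E \<alpha>
          \<or> sol_ln I G\<^sub>0 l H A B C D E \<alpha> \<beta>
          \<or> sol_tan I G\<^sub>0 l H A B C D E \<alpha> \<beta>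
          \<or> sol_tanh I G\<^sub>0 l H A B C D E \<alpha> \<beta>
          \<or> sol_arctan I G\<^sub>0 l H A B C D E \<alpha> \<beta>" by blast
    have D: "D \<noteq> 0" using c by auto
    have eqI: ?eq
      if "\<forall>u\<in>diff_set l I. G\<^sub>0 u = g u"
        and "\<And>x y. x \<in> I \<Longrightarrow> y \<in> I \<Longrightarrow> g (l x - l y) = H ((x + y) / 2) - (H x + H y) / 2" for g
      using equation_iff_G[of I g l H G\<^sub>0] that by blast
    show ?eq
      using sol
    proof (elim disjE)
      assume s: "sol_trivial I G\<^sub>0 l H A B"
      show ?eq
      proof (rule eqI)
        show "\<forall>u\<in>diff_set l I. G\<^sub>0 u = 0" using s by (simp add: sol_trivial_def)
        show "0 = H ((x + y) / 2) - (H x + H y) / 2" if "x \<in> I" "y \<in> I" for x y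
          using s that is_interval_midpoint[OF assms(2) that]
          by (simp add: sol_trivial_def field_simps)
      qed
    next
      assume s: "sol_quadratic I G\<^sub>0 l H A B C D E"
      note s' = s[unfolded sol_quadratic_def]
      show ?eq by (rule eqI[OF conjunct1[OF s']], rule quadratic_identity[OF assms(2) D]) (use s' in blast)+
    next
      assume s: "sol_exp I G\<^sub>0 l H A B C D E \<alpha>"
      note s' = s[unfolded sol_exp_def]
      show ?eq by (rule eqI[OF conjunct1[OF s']], rule exp_identity[OF assms(2) D]) (use s' in blast)+
    next
      assume s: "sol_ln I G\<^sub>0 l H A B C D E \<alpha> \<beta>"
      note s' = s[unfolded sol_ln_def] and nz = sol_ln_nonzero[OF assms(1) cont_l c s]
      show ?eq by (rule eqI[OF conjunct1[OF s']], rule ln_identity[OF assms(2) D]) (use s' nz in blast)+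
    next
      assume s: "sol_tan I G\<^sub>0 l H A B C D E \<alpha> \<beta>"
      note s' = s[unfolded sol_tan_def] and nz = sol_tan_nonzero[OF assms(1) cont_l c s]
      show ?eq by (rule eqI[OF conjunct1[OF s']], rule tan_identity[OF assms(2) D]) (use s' nz in blast)+
    next
      assume s: "sol_tanh I G\<^sub>0 l H A B C D E \<alpha> \<beta>"
      have nz: "sinh (2 * \<alpha> * x + 2 * \<beta>) \<noteq> 0" if "x \<in> I" for x
        using sol_tanh_nonzero[OF assms(1) cont_l c s that] by auto
      note s' = s[unfolded sol_tanh_def]
      show ?eq by (rule eqI[OF conjunct1[OF s']], rule tanh_identity[OF assms(2) D]) (use s' nz in blast)+
    next
      assume s: "sol_arctan I G\<^sub>0 l H A B C D E \<alpha> \<beta>"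
      note s' = s[unfolded sol_arctan_def]
      show ?eq by (rule eqI[OF conjunct1[OF s']], rule arctan_identity[OF assms(2) D]) (use s' in blast)+
    qed
  qed
  moreover have ?side
  proof (intro allI impI conjI)
    fix A B C D E \<alpha> \<beta> :: real assume c: "C * D * \<alpha> \<noteq> 0"
    show "0 \<notin> affine_image \<alpha> \<beta> I" if "sol_ln I G\<^sub>0 l H A B C D E \<alpha> \<beta>"
      using sol_ln_nonzero[OF assms(1) cont_l c that] by (fastforce simp: affine_image_def)
    show "0 \<notin> affine_image \<alpha> \<beta> I" if "sol_tanh I G\<^sub>0 l H A B C D E \<alpha> \<beta>"
      using sol_tanh_nonzero[OF assms(1) cont_l c that] by (fastforce simp: affine_image_def)
    show "\<int> \<inter> (\<lambda>t. 2 / pi * t) ` affine_image \<alpha> \<beta> I = {}" if s: "sol_tan I G\<^sub>0 l H A B C D E \<alpha> \<beta>"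
    proof (rule ccontr)
      assume "\<int> \<inter> (\<lambda>t. 2 / pi * t) ` affine_image \<alpha> \<beta> I \<noteq> {}"
      then obtain x where x: "x \<in> I" and "2 / pi * (\<alpha> * x + \<beta>) \<in> \<int>"
        unfolding affine_image_def by blast
      then obtain n where "2 / pi * (\<alpha> * x + \<beta>) = of_int n" by (auto elim: Ints_cases)
      then have "2 * \<alpha> * x + 2 * \<beta> = of_int n * pi" by (simp add: field_simps)
      then have "sin (2 * \<alpha> * x + 2 * \<beta>) = 0" using sin_zero_iff_int2 by blast
      then show False using sol_tan_nonzero[OF assms(1) cont_l c s x] by blast
    qed
  qed
  ultimately show ?thesis by blast
qed

end
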